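(* Let $D$ be a bounded domain in $\mathbb{R}^m$, $m \geq 2$, and let $v \in C^0(D)$ be real-valued. If for some $\mu > 0$ the equality $$\Gamma\left( \frac{m}{2} \right) \frac{I_{(m-2)/2}(\mu r)}{(\mu r/2)^{(m-2)/2}} \, v(x) = \frac{1}{|\partial B_r|} \int_{\partial B_r(x)} v(y) \, dS_y$$ holds for every $x \in D$ and all $r \in (0, r(x))$, where $r(x) > 0$ is such that the ball $B_{r(x)}(x)$ is admissible, then $v$ satisfies the modified Helmholtz equation $\nabla^2 v - \mu^2 v = 0$ in $D$.
   Context: A domain is an open connected subset of $\mathbb{R}^m$. $B_r(x) = \{ y : |y-x| < r\}$; the ball is called admissible if $\overline{B_r(x)} \subset D$. $|\partial B_r| = 2\pi^{m/2} r^{m-1}/\Gamma(m/2)$ is the area of the sphere of radius $r$, $dS$ is the surface measure, and $I_\nu$ is the modified Bessel function of the first kind of order $\nu$. *)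

theory Defs
  imports "HOL-Analysis.Analysis"
begin

text \<open>
  The surface measure on the sphere of centre \<open>x\<close> and radius \<open>r > 0\<close> in \<open>m\<close>-dimensional Euclidean
  space is the standard one from polar coordinates: the area of a Borel subset \<open>A\<close> of the sphere
  is \<open>m / r\<close> times the Lebesgue measure of the cone over \<open>A\<close> with apex \<open>x\<close>
  (\<open>emeasure_sphere_measure\<close>; the total area is \<open>emeasure_sphere_measure_sphere\<close>).
  It is obtained as a rescaled image of Lebesgue measure on the ball under radial projection.
  It is a Borel measure on the whole space, concentrated on the sphere; the value of the
  projection at \<open>x\<close> itself is irrelevant.
\<close>

definition radial_proj :: "'a::euclidean_space \<Rightarrow> real \<Rightarrow> 'a \<Rightarrow> 'a" where
  "radial_proj x r y = x + (r / norm (y - x)) *\<^sub>R (y - x)"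

definition sphere_measure :: "'a::euclidean_space \<Rightarrow> real \<Rightarrow> 'a measure" where
  "sphere_measure x r = scale_measure (ennreal (real DIM('a) / r))
     (distr (restrict_space lborel (ball x r)) borel (radial_proj x r))"

definition sphere_area :: "nat \<Rightarrow> real \<Rightarrow> real" where
  "sphere_area m r = 2 * pi powr (real m / 2) * r ^ (m - 1) / Gamma (real m / 2)"

lemma radial_proj_measurable [measurable]:
  "radial_proj (x::'a::euclidean_space) r \<in> borel_measurable borel"
  unfolding radial_proj_def by measurable

lemma sets_sphere_measure [simp, measurable_cong]: "sets (sphere_measure x r) = sets borel"
  by (simp add: sphere_measure_def)

lemma space_sphere_measure [simp]: "space (sphere_measure x r) = UNIV"
  by (simp add: sphere_measure_def space_scale_measure)

lemma emeasure_sphere_measure_aux: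
  fixes x :: "'a::euclidean_space"
  assumes "A \<in> sets borel"
  shows "emeasure (sphere_measure x r) A =
    ennreal (real DIM('a) / r) * emeasure lborel (radial_proj x r -` A \<inter> ball x r)"
proof -
  have m: "radial_proj x r \<in> restrict_space lborel (ball x r) \<rightarrow>\<^sub>M borel"
    by (intro measurable_restrict_space1) simp
  show ?thesis
    using assms
    by (simp add: sphere_measure_def emeasure_distr[OF m] space_restrict_space
        emeasure_restrict_space)
qed

lemma radial_proj_vimage:
  fixes x :: "'a::euclidean_space"
  assumes r: "r > 0" and A: "A \<subseteq> sphere x r"
  shows "(radial_proj x r -` A \<inter> ball x r) - {x} = {x + t *\<^sub>R (y - x) | t y. 0 < t \<and> t < 1 \<and> y \<in> A}"
    (is "?L = ?R")
proof (intro equalityI subsetI)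
  fix z assume z: "z \<in> ?L"
  then have n: "norm (z - x) > 0" "norm (z - x) < r"
    by (auto simp: dist_norm norm_minus_commute)
  have "z = x + (norm (z - x) / r) *\<^sub>R (radial_proj x r z - x)"
    using n r by (simp add: radial_proj_def)
  moreover have "0 < norm (z - x) / r" "norm (z - x) / r < 1" using n r by auto
  moreover have "radial_proj x r z \<in> A" using z by auto
  ultimately show "z \<in> ?R" by blast
next
  fix z assume "z \<in> ?R"
  then obtain t y where ty: "z = x + t *\<^sub>R (y - x)" "0 < t" "t < 1" "y \<in> A" by blast
  then have y: "norm (y - x) = r" using A by (auto simp: dist_norm norm_minus_commute)
  have "norm (z - x) = t * r" using ty y by simp
  moreover have "t * r < r" "t * r > 0" using ty r by auto
  moreover have "radial_proj x r z = y"
    using ty y r by (simp add: radial_proj_def)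
  ultimately show "z \<in> ?L" using ty by (auto simp: dist_norm norm_minus_commute)
qed

lemma emeasure_sphere_measure:
  fixes x :: "'a::euclidean_space"
  assumes "r > 0" and "A \<subseteq> sphere x r" and [measurable]: "A \<in> sets borel"
  shows "emeasure (sphere_measure x r) A = ennreal (real DIM('a) / r) *
    emeasure lborel {x + t *\<^sub>R (y - x) | t y. 0 < t \<and> t < 1 \<and> y \<in> A}"
proof -
  have "radial_proj x r -` A \<inter> space borel \<in> sets borel"
    by (rule measurable_sets[OF radial_proj_measurable assms(3)])
  then have B: "radial_proj x r -` A \<inter> ball x r \<in> sets lborel" by simp
  have "emeasure lborel ((radial_proj x r -` A \<inter> ball x r) - {x}) =
    emeasure lborel (radial_proj x r -` A \<inter> ball x r)"
    by (rule emeasure_Diff_null_set) (use B in auto)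
  then show ?thesis
    using radial_proj_vimage[OF assms(1,2)] by (simp add: emeasure_sphere_measure_aux assms(3))
qed

lemma emeasure_sphere_measure_sphere:
  fixes x :: "'a::euclidean_space"
  assumes r: "r > 0"
  shows "emeasure (sphere_measure x r) (sphere x r) = ennreal (sphere_area DIM('a) r)"
proof -
  let ?m = "DIM('a)"
  have m: "real ?m > 0" by simp
  have P: "radial_proj x r -` sphere x r \<inter> ball x r - {x} = ball x r - {x}"
    using r by (auto simp: radial_proj_def dist_norm)
  have "radial_proj x r -` sphere x r \<inter> space borel \<in> sets borel"
    by (rule measurable_sets[OF radial_proj_measurable]) simp
  then have B: "radial_proj x r -` sphere x r \<inter> ball x r \<in> sets lborel" by simp
  have "emeasure lborel (radial_proj x r -` sphere x r \<inter> ball x r) =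
     emeasure lborel (radial_proj x r -` sphere x r \<inter> ball x r - {x})"
    by (rule emeasure_Diff_null_set[symmetric]) (use B in auto)
  also have "\<dots> = emeasure lborel (ball x r)"
    unfolding P by (rule emeasure_Diff_null_set) auto
  also have "\<dots> = ennreal (unit_ball_vol ?m * r ^ ?m)"
    using r by (simp add: emeasure_ball)
  finally have "emeasure (sphere_measure x r) (sphere x r) =
      ennreal (real ?m / r * (unit_ball_vol ?m * r ^ ?m))"
    using r by (simp only: emeasure_sphere_measure_aux[OF borel_closed[OF closed_sphere]])
      (simp flip: ennreal_mult)
  moreover have "real ?m / r * (unit_ball_vol ?m * r ^ ?m) = sphere_area ?m r"
  proof -
    define g where "g = Gamma (real ?m / 2)"
    have G: "Gamma (real ?m / 2 + 1) = real ?m / 2 * g" unfolding g_def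
      using m by (intro Gamma_plus1) (use nonpos_Ints_nonpos[of "real ?m / 2"] in linarith)
    have g: "g > 0" using m unfolding g_def by (intro Gamma_real_pos) simp
    have R: "r ^ ?m = r * r ^ (?m - 1)"
      by (metis DIM_positive power_eq_if not_gr_zero)
    show ?thesis
      unfolding unit_ball_vol_def sphere_area_def G R g_def[symmetric]
      using m r g by (simp add: field_simps)
  qed
  ultimately show ?thesis by simp
qed

definition bessel_I :: "real \<Rightarrow> real \<Rightarrow> real" where
  "bessel_I \<nu> z = (z / 2) powr \<nu> * (\<Sum>k. (z\<^sup>2 / 4) ^ k / (fact k * Gamma (\<nu> + real k + 1)))"

definition partial_deriv :: "'a \<Rightarrow> ('a::euclidean_space \<Rightarrow> real) \<Rightarrow> 'a \<Rightarrow> real" where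
  "partial_deriv b f x = deriv (\<lambda>t. f (x + t *\<^sub>R b)) 0"

definition laplacian :: "('a::euclidean_space \<Rightarrow> real) \<Rightarrow> 'a \<Rightarrow> real" where
  "laplacian f x = (\<Sum>b\<in>Basis. partial_deriv b (partial_deriv b f) x)"

text \<open>
  \<open>C_diff_on k f S\<close>: all partial derivatives of \<open>f\<close> up to order \<open>k\<close> exist and are continuous on
  the open set \<open>S\<close>. The explicit existence clause is needed because \<^const>\<open>deriv\<close> is total.
\<close>

fun C_diff_on :: "nat \<Rightarrow> ('a::euclidean_space \<Rightarrow> real) \<Rightarrow> 'a set \<Rightarrow> bool" where
  "C_diff_on 0 f S \<longleftrightarrow> continuous_on S f"
| "C_diff_on (Suc k) f S \<longleftrightarrow> continuous_on S f \<and>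
     (\<forall>b\<in>Basis. (\<forall>x\<in>S. (\<lambda>t. f (x + t *\<^sub>R b)) field_differentiable at 0) \<and>
                C_diff_on k (partial_deriv b f) S)"

definition satisfies_modified_Helmholtz ::
    "real \<Rightarrow> ('a::euclidean_space \<Rightarrow> real) \<Rightarrow> 'a set \<Rightarrow> bool" where
  "satisfies_modified_Helmholtz \<mu> v D \<longleftrightarrow>
     C_diff_on 2 v D \<and> (\<forall>x\<in>D. laplacian v x - \<mu>\<^sup>2 * v x = 0)"

end

theory Submission
  imports Defs
begin

text \<open>
  The lift \<open>V(x, t) = v(x) cos(\<mu>t)\<close> is harmonic in one more variable iff \<open>v\<close> solves the modified
  Helmholtz equation. Since the admissible radii need not be bounded below on compact sets, mollification
  is not available; instead \<open>V\<close> is compared with harmonic polynomials. These are dense in the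
  continuous functions on any sphere. At an interior maximum of \<open>V\<close> minus a strictly superharmonic
  polynomial, the expansion \<open>1 + \<mu>\<^sup>2 r\<^sup>2/(2m) + o(r\<^sup>2)\<close> of the Bessel factor contradicts the mean
  value property, so approximation on a sphere propagates to the ball. Bernstein's gradient estimate
  then makes the derivatives of the approximating harmonic polynomials converge locally uniformly.
\<close>

subsection \<open>Partial derivatives of polynomial functions\<close>

text \<open>The equation for \<open>v\<close> has no nonzero polynomial solutions, so it offers no
  convenient family to compare \<open>v\<close> with; the Laplace equation for the lift does. On
  each ball the approximating harmonic polynomials take the place of a Poisson integral. The extra
  variable also raises the dimension to at least 3, which keeps the denominator n + 2k - 2 in the
  splitting of polynomials on spheres positive even for degree k = 0. The comparison works in the
  spirit of viscosity solutions: a polynomial touching a multiple of \<open>v\<close> from above at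
  one point inherits a differential inequality from the mean value property there as r tends to 0.
  Hence a positive radius at each point is enough, however it varies with the point. Until the final
  passage to the limit, space derivatives are taken of polynomials only.\<close>

lemma real_polynomial_function_directional:
  fixes f :: "'a::euclidean_space \<Rightarrow> real"
  assumes "real_polynomial_function f"
  shows "\<exists>g. real_polynomial_function g \<and> (\<forall>x. ((\<lambda>t. f (x + t *\<^sub>R b)) has_real_derivative g x) (at 0))"
  using assms
proof (induction rule: real_polynomial_function.induct)
  case (linear f)
  then interpret bounded_linear f .
  have "((\<lambda>t. f (x + t *\<^sub>R b)) has_real_derivative f b) (at 0)" for x
    unfolding add scaleR by (auto intro!: derivative_eq_intros)
  then show ?case by blast
next
  case (const c)
  have "((\<lambda>t. c) has_real_derivative 0) (at 0)" by simp
  then show ?case by (intro exI[of _ "\<lambda>x. 0"]) auto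
next
  case (add f g)
  then obtain f' g' where
    "real_polynomial_function f'" "\<And>x. ((\<lambda>t. f (x + t *\<^sub>R b)) has_real_derivative f' x) (at 0)"
    "real_polynomial_function g'" "\<And>x. ((\<lambda>t. g (x + t *\<^sub>R b)) has_real_derivative g' x) (at 0)"
    by blast
  then show ?case
    by (intro exI[of _ "\<lambda>x. f' x + g' x"]) (auto intro!: derivative_eq_intros)
next
  case (mult f g)
  then obtain f' g' where *:
    "real_polynomial_function f'" "\<And>x. ((\<lambda>t. f (x + t *\<^sub>R b)) has_real_derivative f' x) (at 0)"
    "real_polynomial_function g'" "\<And>x. ((\<lambda>t. g (x + t *\<^sub>R b)) has_real_derivative g' x) (at 0)"
    by blast
  have "((\<lambda>t. f (x + t *\<^sub>R b) * g (x + t *\<^sub>R b)) has_real_derivative f' x * g x + g' x * f x) (at 0)" for x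
    using DERIV_mult[OF *(2)[of x] *(4)[of x]] by simp
  then show ?case using * mult
    by (intro exI[of _ "\<lambda>x. f' x * g x + g' x * f x"]) auto
qed

text \<open>\<open>deriv\<close> is total, so every computation has to establish differentiability
  first. The conclusion is an equation between functions so that iterated partial derivatives can be
  rewritten.\<close>

lemma partial_deriv_eq_fun:
  assumes "\<And>x. ((\<lambda>t. f (x + t *\<^sub>R b)) has_real_derivative g x) (at 0)"
  shows "partial_deriv b f = g"
  using assms by (intro ext) (simp add: partial_deriv_def DERIV_imp_deriv)

context
  fixes f :: "'a::euclidean_space \<Rightarrow> real"
  assumes f: "real_polynomial_function f"
begin

lemma real_polynomial_function_partial_deriv: "real_polynomial_function (partial_deriv b f)"
  using real_polynomial_function_directional[OF f, of b] partial_deriv_eq_fun by metis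

lemma has_partial_deriv_poly:
  "((\<lambda>t. f (x + t *\<^sub>R b)) has_real_derivative partial_deriv b f x) (at 0)"
  using real_polynomial_function_directional[OF f, of b] partial_deriv_eq_fun by metis

lemma has_partial_deriv_poly_at:
  "((\<lambda>t. f (x + t *\<^sub>R b)) has_real_derivative partial_deriv b f (x + t *\<^sub>R b)) (at t)"
proof -
  have "((\<lambda>s. f ((x + t *\<^sub>R b) + s *\<^sub>R b)) has_real_derivative partial_deriv b f (x + t *\<^sub>R b)) (at 0)"
    by (rule has_partial_deriv_poly)
  also have "(\<lambda>s. f ((x + t *\<^sub>R b) + s *\<^sub>R b)) = (\<lambda>s. f (x + (s + t) *\<^sub>R b))"
    by (simp add: algebra_simps)
  finally show ?thesis
    using DERIV_shift[of "\<lambda>t. f (x + t *\<^sub>R b)" _ 0 t] by (simp add: add.commute)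
qed

end

lemma partial_deriv_const [simp]: "partial_deriv b (\<lambda>x. c) = (\<lambda>x. 0)"
  by (rule partial_deriv_eq_fun) simp

lemma partial_deriv_bounded_linear:
  assumes "bounded_linear f"
  shows "partial_deriv b f = (\<lambda>x. f b)"
proof -
  interpret bounded_linear f by fact
  show ?thesis
    by (rule partial_deriv_eq_fun) (unfold add scaleR, auto intro!: derivative_eq_intros)
qed

context
  fixes f g :: "'a::euclidean_space \<Rightarrow> real"
  assumes f: "real_polynomial_function f" and g: "real_polynomial_function g"
begin

lemma partial_deriv_add:
  "partial_deriv b (\<lambda>x. f x + g x) = (\<lambda>x. partial_deriv b f x + partial_deriv b g x)"
  using DERIV_add[OF has_partial_deriv_poly[OF f] has_partial_deriv_poly[OF g]]
  by (intro partial_deriv_eq_fun) auto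

lemma partial_deriv_diff:
  "partial_deriv b (\<lambda>x. f x - g x) = (\<lambda>x. partial_deriv b f x - partial_deriv b g x)"
  using DERIV_diff[OF has_partial_deriv_poly[OF f] has_partial_deriv_poly[OF g]]
  by (intro partial_deriv_eq_fun) auto

lemma partial_deriv_mult:
  "partial_deriv b (\<lambda>x. f x * g x) = (\<lambda>x. f x * partial_deriv b g x + g x * partial_deriv b f x)"
proof (rule partial_deriv_eq_fun)
  fix x
  show "((\<lambda>t. f (x + t *\<^sub>R b) * g (x + t *\<^sub>R b)) has_real_derivative
      f x * partial_deriv b g x + g x * partial_deriv b f x) (at 0)"
    using DERIV_mult[OF has_partial_deriv_poly[OF f, of x b] has_partial_deriv_poly[OF g, of x b]]
    by (simp add: algebra_simps)
qed

end

lemma partial_deriv_cmult: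
  assumes "real_polynomial_function f"
  shows "partial_deriv b (\<lambda>x. a * f x) = (\<lambda>x. a * partial_deriv b f x)"
  using partial_deriv_mult[OF real_polynomial_function.intros(2) assms] by simp

lemma partial_deriv_sum:
  assumes "finite I" "\<And>i. i \<in> I \<Longrightarrow> real_polynomial_function (f i)"
  shows "partial_deriv b (\<lambda>x. \<Sum>i\<in>I. f i x) = (\<lambda>x. \<Sum>i\<in>I. partial_deriv b (f i) x)"
  using assms
  by (induction rule: finite_induct)
    (auto simp: partial_deriv_add real_polynomial_function_sum)

text \<open>Symmetry of second derivatives is algebraic for polynomials: the product rule applied
  twice gives an expression symmetric in \<open>a\<close> and \<open>b\<close>.\<close>

lemma partial_deriv_commute:
  fixes f :: "'a::euclidean_space \<Rightarrow> real"
  assumes "real_polynomial_function f"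
  shows "partial_deriv a (partial_deriv b f) = partial_deriv b (partial_deriv a f)"
  using assms
proof (induction rule: real_polynomial_function.induct)
  case (linear f)
  then show ?case by (simp add: partial_deriv_bounded_linear)
next
  case (const c)
  then show ?case by simp
next
  case (add f g)
  then show ?case
    by (simp add: partial_deriv_add real_polynomial_function_partial_deriv)
next
  case (mult f g)
  then show ?case
    by (simp add: partial_deriv_add partial_deriv_mult real_polynomial_function_partial_deriv
        real_polynomial_function.intros algebra_simps)
qed

text \<open>The direction \<open>y\<close> is an arbitrary vector, so it may be taken to be
  \<open>x - c\<close> at the point \<open>x\<close>. This gives the Euler operator, which measures
  degrees about \<open>c\<close>.\<close>

lemma partial_deriv_Basis_expansion:
  fixes f :: "'a::euclidean_space \<Rightarrow> real"
  assumes "real_polynomial_function f"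
  shows "partial_deriv y f x = (\<Sum>b\<in>Basis. (y \<bullet> b) * partial_deriv b f x)"
  using assms
proof (induction rule: real_polynomial_function.induct)
  case (linear f)
  note bl = linear
  interpret bounded_linear f by (fact bl)
  have "f y = f (\<Sum>b\<in>Basis. (y \<bullet> b) *\<^sub>R b)" by (simp add: euclidean_representation)
  also have "\<dots> = (\<Sum>b\<in>Basis. (y \<bullet> b) * f b)" by (simp add: sum scaleR)
  finally show ?case using partial_deriv_bounded_linear[OF bl] by simp
next
  case (const c)
  then show ?case by simp
next
  case (add f g)
  then show ?case
    by (simp add: partial_deriv_add algebra_simps sum.distrib)
next
  case (mult f g)
  then show ?case
    by (simp add: partial_deriv_mult algebra_simps sum.distrib sum_distrib_left)
qed

section \<open>The Laplacian on polynomial functions\<close>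

lemma real_polynomial_function_laplacian:
  assumes "real_polynomial_function f"
  shows "real_polynomial_function (laplacian f)"
  unfolding laplacian_def
  by (intro real_polynomial_function_sum real_polynomial_function_partial_deriv assms) auto

lemma laplacian_const [simp]: "laplacian (\<lambda>x. c) x = 0"
  by (simp add: laplacian_def)

lemma laplacian_partial_deriv:
  assumes f: "real_polynomial_function f"
  shows "laplacian (partial_deriv b f) = partial_deriv b (laplacian f)"
proof -
  have "partial_deriv b (laplacian f) = (\<lambda>x. \<Sum>i\<in>Basis. partial_deriv b (partial_deriv i (partial_deriv i f)) x)"
    unfolding laplacian_def
    by (rule partial_deriv_sum) (simp_all add: f real_polynomial_function_partial_deriv)
  also have "\<dots> = laplacian (partial_deriv b f)"
    unfolding laplacian_def
    by (simp add: partial_deriv_commute[of _ b] f real_polynomial_function_partial_deriv)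
  finally show ?thesis by simp
qed

lemma laplacian_add:
  assumes "real_polynomial_function f" "real_polynomial_function g"
  shows "laplacian (\<lambda>x. f x + g x) x = laplacian f x + laplacian g x"
  using assms by (simp add: laplacian_def partial_deriv_add real_polynomial_function_partial_deriv sum.distrib)

lemma laplacian_diff:
  assumes "real_polynomial_function f" "real_polynomial_function g"
  shows "laplacian (\<lambda>x. f x - g x) x = laplacian f x - laplacian g x"
  using assms by (simp add: laplacian_def partial_deriv_diff real_polynomial_function_partial_deriv sum_subtractf)

lemma laplacian_cmult:
  assumes "real_polynomial_function f"
  shows "laplacian (\<lambda>x. a * f x) x = a * laplacian f x"
  using assms by (simp add: laplacian_def partial_deriv_cmult real_polynomial_function_partial_deriv sum_distrib_left)

lemma laplacian_mult:
  assumes "real_polynomial_function f" "real_polynomial_function g"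
  shows "laplacian (\<lambda>x. f x * g x) x = f x * laplacian g x + g x * laplacian f x
    + 2 * (\<Sum>b\<in>Basis. partial_deriv b f x * partial_deriv b g x)"
  using assms
  by (simp add: laplacian_def partial_deriv_add partial_deriv_mult real_polynomial_function_partial_deriv
      real_polynomial_function.intros sum.distrib sum_distrib_left algebra_simps)

lemma real_polynomial_function_coord: "real_polynomial_function (\<lambda>x::'a::euclidean_space. (x - c) \<bullet> i)"
  by (simp add: inner_diff_left real_polynomial_function_diff real_polynomial_function.intros bounded_linear_inner_left)

lemma partial_deriv_coord: "partial_deriv b (\<lambda>x::'a::euclidean_space. (x - c) \<bullet> i) = (\<lambda>x. b \<bullet> i)"
  by (rule partial_deriv_eq_fun) (auto intro!: derivative_eq_intros simp: inner_diff_left inner_add_left)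

lemma laplacian_coord: "laplacian (\<lambda>x::'a::euclidean_space. (x - c) \<bullet> i) x = 0"
  by (simp add: laplacian_def partial_deriv_coord)

lemma real_polynomial_function_sq_dist: "real_polynomial_function (\<lambda>x::'a::euclidean_space. (norm (x - c))\<^sup>2)"
proof -
  have "(norm (x - c))\<^sup>2 = (\<Sum>b\<in>Basis. ((x - c) \<bullet> b) * ((x - c) \<bullet> b))" for x
    by (simp add: power2_norm_eq_inner euclidean_inner[of "x-c" "x-c"])
  then show ?thesis
    by (simp add: real_polynomial_function_sum real_polynomial_function.intros(4) real_polynomial_function_coord)
qed

lemma partial_deriv_sq_dist: "partial_deriv b (\<lambda>x::'a::euclidean_space. (norm (x - c))\<^sup>2) = (\<lambda>x. 2 * ((x - c) \<bullet> b))"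
proof (rule partial_deriv_eq_fun)
  fix x
  have *: "(norm (u + t *\<^sub>R b))\<^sup>2 = (norm u)\<^sup>2 + 2 * t * (u \<bullet> b) + t\<^sup>2 * (norm b)\<^sup>2" for u t
    unfolding power2_norm_eq_inner
    by (simp add: inner_add_left inner_add_right inner_commute power2_eq_square del: dot_square_norm)
  have "(\<lambda>t. (norm (x + t *\<^sub>R b - c))\<^sup>2) = (\<lambda>t. (norm (x - c))\<^sup>2 + 2 * t * ((x - c) \<bullet> b) + t\<^sup>2 * (norm b)\<^sup>2)"
    using *[of "x - c"] by (simp add: diff_add_eq)
  then show "((\<lambda>t. (norm (x + t *\<^sub>R b - c))\<^sup>2) has_real_derivative 2 * ((x - c) \<bullet> b)) (at 0)"
    by (auto intro!: derivative_eq_intros)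
qed

lemma laplacian_sq_dist: "laplacian (\<lambda>x::'a::euclidean_space. (norm (x - c))\<^sup>2) x = 2 * real DIM('a)"
  unfolding laplacian_def partial_deriv_sq_dist
  by (simp add: partial_deriv_cmult[OF real_polynomial_function_coord] partial_deriv_coord)

text \<open>The gradient of the squared distance is 2(x - c), so the cross term in the Laplacian of
  a product with it is an Euler operator.\<close>

lemma sum_partial_deriv_sq_dist:
  assumes "real_polynomial_function (f :: 'a::euclidean_space \<Rightarrow> real)"
  shows "(\<Sum>b\<in>Basis. partial_deriv b (\<lambda>x. (norm (x - c))\<^sup>2) x * partial_deriv b f x) = 2 * partial_deriv (x - c) f x"
  by (simp add: partial_deriv_sq_dist partial_deriv_Basis_expansion[OF assms, of "x-c"] sum_distrib_left mult_ac)

subsection \<open>Density of harmonic polynomials on spheres\<close>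

lemmas polynomial_intros =
  real_polynomial_function_partial_deriv real_polynomial_function_laplacian
  real_polynomial_function_coord real_polynomial_function_sq_dist
  real_polynomial_function.intros real_polynomial_function_diff
  real_polynomial_function_minus real_polynomial_function_power real_polynomial_function_divide

definition harmonic_polynomial :: "('a::euclidean_space \<Rightarrow> real) \<Rightarrow> bool" where
  "harmonic_polynomial h \<longleftrightarrow> real_polynomial_function h \<and> (\<forall>x. laplacian h x = 0)"

lemma harmonic_polynomial_partial_deriv:
  assumes "harmonic_polynomial h"
  shows "harmonic_polynomial (partial_deriv b h)"
proof -
  have "laplacian h = (\<lambda>x. 0)" using assms by (auto simp: harmonic_polynomial_def)
  then show ?thesis
    using assms by (simp add: harmonic_polynomial_def laplacian_partial_deriv polynomial_intros)
qed

lemma harmonic_polynomial_diff: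
  "harmonic_polynomial f \<Longrightarrow> harmonic_polynomial g \<Longrightarrow> harmonic_polynomial (\<lambda>x. f x - g x)"
  by (simp add: harmonic_polynomial_def laplacian_diff real_polynomial_function_diff)

lemma harmonic_polynomial_uminus:
  assumes "harmonic_polynomial f"
  shows "harmonic_polynomial (\<lambda>x. - f x)"
proof -
  have "harmonic_polynomial (\<lambda>x. 0)"
    by (simp add: harmonic_polynomial_def polynomial_intros)
  from harmonic_polynomial_diff[OF this assms] show ?thesis by simp
qed

text \<open>Homogeneity about \<open>c\<close> is expressed by Euler's identity.\<close>

definition homogeneous_harmonic :: "'a::euclidean_space \<Rightarrow> nat \<Rightarrow> ('a \<Rightarrow> real) \<Rightarrow> bool" where
  "homogeneous_harmonic c k h \<longleftrightarrow>
     harmonic_polynomial h \<and> (\<forall>x. partial_deriv (x - c) h x = real k * h x)"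

lemma homogeneous_harmonic_cmult:
  assumes "homogeneous_harmonic c k h"
  shows "homogeneous_harmonic c k (\<lambda>x. a * h x)"
  using assms
  by (auto simp: homogeneous_harmonic_def harmonic_polynomial_def partial_deriv_cmult laplacian_cmult
      polynomial_intros)

text \<open>In degree 0 Euler's identity says that the radial derivative vanishes, so
  \<open>h\<close> is constant on each ray from \<open>c\<close>.\<close>

lemma homogeneous_harmonic_0_const:
  assumes "homogeneous_harmonic c 0 h"
  shows "h = (\<lambda>x. h c)"
proof
  fix x
  have h: "real_polynomial_function h" and e: "\<And>x. partial_deriv (x - c) h x = 0"
    using assms by (auto simp: homogeneous_harmonic_def harmonic_polynomial_def)
  have d: "((\<lambda>t. h (c + t *\<^sub>R (x - c))) has_real_derivative
      partial_deriv (x - c) h (c + t *\<^sub>R (x - c))) (at t)" for t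
    by (rule has_partial_deriv_poly_at[OF h])
  \<comment> \<open>At the point \<open>c + t *\<^sub>R (x - c)\<close> Euler's identity
    differentiates along \<open>t *\<^sub>R (x - c)\<close>; the factor \<open>t\<close> is positive
    and divides out.\<close>
  have z: "partial_deriv (x - c) h (c + t *\<^sub>R (x - c)) = 0" if "t > 0" for t
  proof -
    have "0 = (\<Sum>b\<in>Basis. (t *\<^sub>R (x - c) \<bullet> b) * partial_deriv b h (c + t *\<^sub>R (x - c)))"
      using e[of "c + t *\<^sub>R (x - c)"] by (simp add: partial_deriv_Basis_expansion[OF h, of "t *\<^sub>R (x - c)"])
    also have "\<dots> = t * partial_deriv (x - c) h (c + t *\<^sub>R (x - c))"
      by (simp add: partial_deriv_Basis_expansion[OF h, of "x - c"] sum_distrib_left mult.assoc)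
    finally show ?thesis using that by simp
  qed
  have "h (c + 1 *\<^sub>R (x - c)) = h (c + 0 *\<^sub>R (x - c))"
  proof (rule DERIV_isconst2[where a = 0 and b = 1 and f = "\<lambda>t. h (c + t *\<^sub>R (x - c))"])
    show "continuous_on {0..1} (\<lambda>t. h (c + t *\<^sub>R (x - c)))"
      by (intro DERIV_continuous_on) (rule DERIV_subset[OF d], simp)
    show "((\<lambda>t. h (c + t *\<^sub>R (x - c))) has_real_derivative 0) (at t)" if "0 < t" for t
      using d[of t] z[OF that] by simp
  qed auto
  then show "h x = h c" by simp
qed

text \<open>Differentiating Euler's identity in direction \<open>i\<close> also hits the
  coefficients (x - c) \<bullet> b. This produces one extra copy of the derivative of
  \<open>h\<close>, which lowers the degree by one.\<close>

lemma homogeneous_harmonic_partial_deriv: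
  assumes "homogeneous_harmonic c (Suc k) h"
  shows "homogeneous_harmonic c k (partial_deriv i h)"
proof -
  have h: "real_polynomial_function h" and hh: "harmonic_polynomial h"
    and e: "\<And>x. partial_deriv (x - c) h x = real (Suc k) * h x"
    using assms by (auto simp: homogeneous_harmonic_def harmonic_polynomial_def)
  have "partial_deriv (x - c) (partial_deriv i h) x = real k * partial_deriv i h x" for x
  proof -
    have "real (Suc k) * partial_deriv i h x = partial_deriv i (\<lambda>x. \<Sum>b\<in>Basis. ((x - c) \<bullet> b) * partial_deriv b h x) x"
      using e by (simp only: partial_deriv_cmult[OF h] flip: partial_deriv_Basis_expansion[OF h])
    also have "\<dots> = (\<Sum>b\<in>Basis. ((x - c) \<bullet> b) * partial_deriv i (partial_deriv b h) x + partial_deriv b h x * (i \<bullet> b))"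
      by (simp add: partial_deriv_sum partial_deriv_mult partial_deriv_coord polynomial_intros h)
    also have "\<dots> = partial_deriv (x - c) (partial_deriv i h) x + partial_deriv i h x"
      by (simp add: partial_deriv_Basis_expansion[OF h, of i] sum.distrib mult.commute
          partial_deriv_Basis_expansion[OF real_polynomial_function_partial_deriv[OF h], of "x - c"]
          partial_deriv_commute[OF h, of i])
    finally show ?thesis by (simp add: algebra_simps)
  qed
  then show ?thesis
    using harmonic_polynomial_partial_deriv[OF hh] by (simp add: homogeneous_harmonic_def)
qed

text \<open>The subtracted multiple of \<open>\<bar>x - c\<bar>\<^sup>2\<close> cancels the Laplacian \<open>2 \<partial>\<^sub>i h\<close> of the product
  \<open>(x - c)\<^sub>i h\<close>, while on a sphere about \<open>c\<close> it is
  a harmonic polynomial of lower degree.\<close>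

lemma homogeneous_harmonic_coord_mult:
  fixes c :: "'a::euclidean_space"
  assumes h: "homogeneous_harmonic c k h" and i: "i \<in> Basis" and dim: "DIM('a) + 2 * k > 2"
  shows "homogeneous_harmonic c (Suc k) (\<lambda>x. ((x - c) \<bullet> i) * h x
    - (norm (x - c))\<^sup>2 * ((1 / (real DIM('a) + 2 * real k - 2)) * partial_deriv i h x))"
    (is "homogeneous_harmonic c _ (\<lambda>x. ?l x * h x - ?n x * ?g x)")
proof -
  \<comment> \<open>With n = \<open>DIM('a)\<close> and \<open>g\<close> of degree k - 1, the
    Laplacian of the squared distance times \<open>g\<close> is (2n + 4(k - 1)) g = 2(n + 2k - 2) g.
    Equating it with twice the derivative of \<open>h\<close> along \<open>i\<close> fixes
    \<open>a\<close>.\<close>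
  define a where "a = 1 / (real DIM('a) + 2 * real k - 2)"
  have p: "real_polynomial_function h" and l: "\<And>x. laplacian h x = 0"
    and e: "\<And>x. partial_deriv (x - c) h x = real k * h x"
    using h by (auto simp: homogeneous_harmonic_def harmonic_polynomial_def)
  define g where "g = (\<lambda>x. a * partial_deriv i h x)"
  have pg: "real_polynomial_function g" by (simp add: g_def polynomial_intros p)
  \<comment> \<open>The difference \<open>real k - 1\<close> is taken in the reals; for k = 0 it
    equals -1, and the identity survives because \<open>g\<close> is then 0.\<close>
  have eg: "partial_deriv (x - c) g x = (real k - 1) * g x" and lg: "laplacian g x = 0" for x
  proof -
    show "laplacian g x = 0"
      using harmonic_polynomial_partial_deriv[of h] h
      by (simp add: g_def laplacian_cmult polynomial_intros p homogeneous_harmonic_def harmonic_polynomial_def)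
    show "partial_deriv (x - c) g x = (real k - 1) * g x"
    proof (cases k)
      case 0
      then have "h = (\<lambda>x. h c)" using homogeneous_harmonic_0_const h by blast
      then have "partial_deriv i h = (\<lambda>x. 0)" by (metis partial_deriv_const)
      then show ?thesis by (simp add: g_def)
    next
      case (Suc k')
      then have "homogeneous_harmonic c k' g"
        unfolding g_def using h homogeneous_harmonic_partial_deriv homogeneous_harmonic_cmult by blast
      then show ?thesis using Suc by (simp add: homogeneous_harmonic_def)
    qed
  qed
  have q: "real_polynomial_function (\<lambda>x. ?l x * h x - ?n x * g x)"
    by (intro polynomial_intros p pg)
  have "laplacian (\<lambda>x. ?l x * h x - ?n x * g x) x = 0" for x
  proof -
    have "(\<Sum>b\<in>Basis. partial_deriv b ?l x * partial_deriv b h x) = partial_deriv i h x"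
      unfolding partial_deriv_coord partial_deriv_Basis_expansion[OF p, of i]
      by (simp add: inner_commute)
    moreover have "partial_deriv i h x = (real DIM('a) + 2 * real k - 2) * g x"
      using dim by (simp add: g_def a_def)
    moreover have "laplacian (\<lambda>x. ?l x * h x - ?n x * g x) x
        = 2 * (\<Sum>b\<in>Basis. partial_deriv b ?l x * partial_deriv b h x)
          - (g x * (2 * real DIM('a)) + 2 * (2 * ((real k - 1) * g x)))"
      by (simp add: laplacian_diff laplacian_mult polynomial_intros p pg laplacian_coord l lg
          laplacian_sq_dist sum_partial_deriv_sq_dist eg)
    ultimately show ?thesis by (simp add: ring_distribs)
  qed
  moreover have "partial_deriv (x - c) (\<lambda>x. ?l x * h x - ?n x * g x) x
      = real (Suc k) * (?l x * h x - ?n x * g x)" for x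
  proof -
    have "partial_deriv (x - c) (\<lambda>x. ?l x * h x - ?n x * g x) x
        = ?l x * (real k * h x) + h x * ?l x - (?n x * ((real k - 1) * g x) + g x * (2 * ?n x))"
      by (simp add: partial_deriv_diff partial_deriv_mult polynomial_intros p pg partial_deriv_coord
          partial_deriv_sq_dist e eg dot_square_norm)
    then show ?thesis by (simp add: ring_distribs)
  qed
  ultimately show ?thesis
    using q unfolding g_def a_def by (simp add: homogeneous_harmonic_def harmonic_polynomial_def)
qed

text \<open>The correction for a product with a coordinate depends on the degree, so functions are
  kept as finite sums of homogeneous pieces about one centre and treated piece by piece.\<close>

inductive harmonic_sum :: "'a::euclidean_space \<Rightarrow> ('a \<Rightarrow> real) \<Rightarrow> bool" for c where
  base: "homogeneous_harmonic c k h \<Longrightarrow> harmonic_sum c h"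
| add: "harmonic_sum c f \<Longrightarrow> harmonic_sum c g \<Longrightarrow> harmonic_sum c (\<lambda>x. f x + g x)"

lemma harmonic_sum_imp_harmonic_polynomial:
  "harmonic_sum c f \<Longrightarrow> harmonic_polynomial f"
  by (induction rule: harmonic_sum.induct)
    (auto simp: homogeneous_harmonic_def harmonic_polynomial_def laplacian_add polynomial_intros)

lemma harmonic_sum_cmult:
  "harmonic_sum c f \<Longrightarrow> harmonic_sum c (\<lambda>x. a * f x)"
proof (induction rule: harmonic_sum.induct)
  case (base k h)
  then show ?case using homogeneous_harmonic_cmult harmonic_sum.base by blast
next
  case (add f g)
  then show ?case using harmonic_sum.add[OF add.IH] by (simp add: ring_distribs)
qed

lemma harmonic_sum_const: "harmonic_sum c (\<lambda>x. a)"
  by (rule harmonic_sum.base[where k = 0])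
    (simp add: homogeneous_harmonic_def harmonic_polynomial_def polynomial_intros)

lemma harmonic_sum_sum:
  assumes "finite I" "\<And>i. i \<in> I \<Longrightarrow> harmonic_sum c (f i)"
  shows "harmonic_sum c (\<lambda>x. \<Sum>i\<in>I. f i x)"
  using assms by (induction rule: finite_induct) (auto intro: harmonic_sum_const harmonic_sum.add)

text \<open>On the sphere the factor |x - c|^2 is the constant R^2. The product is therefore a
  harmonic piece of degree k + 1 plus a multiple of a derivative of \<open>h\<close>, which is again
  harmonic. Requiring dimension above 2 admits every degree, including k = 0.\<close>

lemma harmonic_sum_coord_mult:
  fixes c :: "'a::euclidean_space"
  assumes f: "harmonic_sum c f" and i: "i \<in> Basis" and dim: "DIM('a) > 2"
  shows "\<exists>g. harmonic_sum c g \<and> (\<forall>x\<in>sphere c R. ((x - c) \<bullet> i) * f x = g x)"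
  using f
proof (induction rule: harmonic_sum.induct)
  case (base k h)
  let ?a = "1 / (real DIM('a) + 2 * real k - 2)"
  define g1 where "g1 = (\<lambda>x. ((x - c) \<bullet> i) * h x - (norm (x - c))\<^sup>2 * (?a * partial_deriv i h x))"
  have 1: "harmonic_sum c g1"
    unfolding g1_def
    by (rule harmonic_sum.base[OF homogeneous_harmonic_coord_mult[OF base i]]) (use dim in simp)
  have 2: "harmonic_sum c (partial_deriv i h)"
  proof (cases k)
    case 0
    then have "h = (\<lambda>x. h c)" using homogeneous_harmonic_0_const base by blast
    then have "partial_deriv i h = (\<lambda>x. 0)" by (metis partial_deriv_const)
    then show ?thesis using harmonic_sum_const[of c 0] by simp
  next
    case (Suc k')
    then show ?thesis
      using base by (intro harmonic_sum.base[where k = k'] homogeneous_harmonic_partial_deriv) simp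
  qed
  have "harmonic_sum c (\<lambda>x. g1 x + (R\<^sup>2 * ?a) * partial_deriv i h x)"
    by (intro harmonic_sum.add 1 harmonic_sum_cmult 2)
  moreover have "\<forall>x\<in>sphere c R. ((x - c) \<bullet> i) * h x = g1 x + (R\<^sup>2 * ?a) * partial_deriv i h x"
    by (auto simp: g1_def dist_norm norm_minus_commute)
  ultimately show ?case by blast
next
  case (add f g)
  then obtain f' g' where "harmonic_sum c f'" "\<forall>x\<in>sphere c R. ((x - c) \<bullet> i) * f x = f' x"
    "harmonic_sum c g'" "\<forall>x\<in>sphere c R. ((x - c) \<bullet> i) * g x = g' x" by blast
  then show ?case
    by (intro exI[of _ "\<lambda>x. f' x + g' x"]) (auto simp: ring_distribs intro: harmonic_sum.add)
qed

text \<open>Restricted to a sphere, harmonic sums form a module over the polynomials. Stating this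
  for every \<open>f\<close>, and not just for \<open>f = 1\<close>, lets the product case apply one
  factor after the other.\<close>

lemma harmonic_sum_polynomial_mult:
  fixes c :: "'a::euclidean_space"
  assumes p: "real_polynomial_function p" and dim: "DIM('a) > 2" and f: "harmonic_sum c f"
  shows "\<exists>g. harmonic_sum c g \<and> (\<forall>x\<in>sphere c R. p x * f x = g x)"
  using p f
proof (induction arbitrary: f rule: real_polynomial_function.induct)
  case (linear p)
  interpret p: bounded_linear p by (rule linear.hyps)
  have "\<forall>i\<in>Basis. \<exists>g. harmonic_sum c g \<and> (\<forall>x\<in>sphere c R. ((x - c) \<bullet> i) * f x = g x)"
    using harmonic_sum_coord_mult[OF linear.prems _ dim] by blast
  then obtain g where g: "\<And>i. i \<in> Basis \<Longrightarrow> harmonic_sum c (g i)"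
    "\<And>i x. i \<in> Basis \<Longrightarrow> x \<in> sphere c R \<Longrightarrow> ((x - c) \<bullet> i) * f x = g i x" by metis
  have "harmonic_sum c (\<lambda>x. p c * f x + (\<Sum>i\<in>Basis. p i * g i x))"
    by (intro harmonic_sum.add harmonic_sum_cmult linear.prems harmonic_sum_sum g) auto
  moreover have "p x * f x = p c * f x + (\<Sum>i\<in>Basis. p i * g i x)" if "x \<in> sphere c R" for x
  proof -
    have "p x = p c + p (\<Sum>i\<in>Basis. ((x - c) \<bullet> i) *\<^sub>R i)"
      by (simp add: euclidean_representation flip: p.add)
    also have "\<dots> = p c + (\<Sum>i\<in>Basis. ((x - c) \<bullet> i) * p i)"
      by (simp add: p.sum p.scaleR)
    finally show ?thesis
      by (simp add: ring_distribs sum_distrib_left mult_ac flip: g(2)[OF _ that])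
  qed
  ultimately show ?case by blast
next
  case (const a)
  then show ?case using harmonic_sum_cmult by blast
next
  case (add p q)
  obtain f' g' where "harmonic_sum c f'" "\<forall>x\<in>sphere c R. p x * f x = f' x"
    "harmonic_sum c g'" "\<forall>x\<in>sphere c R. q x * f x = g' x"
    using add.IH[OF add.prems] by blast
  then show ?case
    by (intro exI[of _ "\<lambda>x. f' x + g' x"]) (auto simp: ring_distribs intro: harmonic_sum.add)
next
  case (mult p q)
  obtain g where g: "harmonic_sum c g" "\<forall>x\<in>sphere c R. q x * f x = g x"
    using mult.IH(2)[OF mult.prems] by blast
  obtain h where "harmonic_sum c h" "\<forall>x\<in>sphere c R. p x * g x = h x"
    using mult.IH(1)[OF g(1)] by blast
  then show ?case using g by (intro exI[of _ h]) (auto simp: mult.assoc)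
qed

text \<open>A polynomial from Stone-Weierstrass acts on the constant 1, and the result is a harmonic
  polynomial with the same values on the sphere.\<close>

lemma harmonic_polynomial_approx_sphere:
  fixes c :: "'a::euclidean_space"
  assumes dim: "DIM('a) > 2" and F: "continuous_on (sphere c R) F" and e: "e > 0"
  shows "\<exists>h. harmonic_polynomial h \<and> (\<forall>x\<in>sphere c R. \<bar>F x - h x\<bar> < e)"
proof -
  obtain p where p: "real_polynomial_function p" "\<And>x. x \<in> sphere c R \<Longrightarrow> \<bar>F x - p x\<bar> < e"
    using Stone_Weierstrass_real_polynomial_function[OF compact_sphere F e] by metis
  obtain h where h: "harmonic_sum c h" "\<forall>x\<in>sphere c R. p x * 1 = h x"
    using harmonic_sum_polynomial_mult[OF p(1) dim harmonic_sum_const, of c R 1] by auto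
  have "\<bar>F x - h x\<bar> < e" if "x \<in> sphere c R" for x
    using p(2)[OF that] h(2) that by simp
  then show ?thesis
    using harmonic_sum_imp_harmonic_polynomial[OF h(1)] by auto
qed

subsection \<open>Maximum principle and gradient estimate\<close>

lemma continuous_on_real_polynomial_function:
  "real_polynomial_function p \<Longrightarrow> continuous_on S p"
  by (simp add: continuous_at_imp_continuous_on continuous_real_polymonial_function)

text \<open>If \<open>D\<close> were positive, \<open>f'\<close> would vanish at \<open>a\<close>
  and be positive just to the right of it, so by the mean value theorem \<open>f\<close> would
  exceed its maximum.\<close>

lemma second_derivative_local_max:
  fixes f :: "real \<Rightarrow> real"
  assumes f: "\<And>t. (f has_real_derivative f' t) (at t)"
    and f': "(f' has_real_derivative D) (at a)"
    and d: "d > 0" and max: "\<And>t. \<bar>t - a\<bar> < d \<Longrightarrow> f t \<le> f a"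
  shows "D \<le> 0"
proof (rule ccontr)
  assume "\<not> D \<le> 0"
  then obtain e where e: "e > 0" "\<And>h. h > 0 \<Longrightarrow> h < e \<Longrightarrow> f' a < f' (a + h)"
    using DERIV_pos_inc_right[OF f', of] by auto
  have 0: "f' a = 0"
    using DERIV_local_max[OF f d] max by (simp add: abs_minus_commute)
  define h where "h = min d e / 2"
  have h: "h > 0" "h < d" "h < e" using d e by (auto simp: h_def)
  obtain z where z: "a < z" "z < a + h" "f (a + h) - f a = (a + h - a) * f' z"
    using MVT2[of a "a + h" f f'] f h by auto
  have "f' z > 0" using e(2)[of "z - a"] z h 0 by auto
  then have "f (a + h) > f a" using z h by (metis add_diff_cancel_left' diff_gt_0_iff_gt mult_pos_pos)
  then show False using max[of "a + h"] h by auto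
qed

lemma partial_deriv2_local_max:
  assumes w: "real_polynomial_function w" and d: "d > 0"
    and max: "\<And>y. dist y x < d \<Longrightarrow> w y \<le> w x" and b: "b \<in> Basis"
  shows "partial_deriv b (partial_deriv b w) x \<le> 0"
proof (rule second_derivative_local_max[where a = 0 and d = d])
  show "((\<lambda>t. w (x + t *\<^sub>R b)) has_real_derivative partial_deriv b w (x + t *\<^sub>R b)) (at t)" for t
    by (rule has_partial_deriv_poly_at[OF w])
  show "((\<lambda>t. partial_deriv b w (x + t *\<^sub>R b)) has_real_derivative partial_deriv b (partial_deriv b w) x) (at 0)"
    by (rule has_partial_deriv_poly) (intro polynomial_intros w)
  show "w (x + t *\<^sub>R b) \<le> w (x + 0 *\<^sub>R b)" if "\<bar>t - 0\<bar> < d" for t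
    using that max[of "x + t *\<^sub>R b"] b by (simp add: dist_norm)
qed (fact d)

lemma continuous_attains_sup_ball_interior:
  fixes W :: "'a::euclidean_space \<Rightarrow> real"
  assumes "continuous_on (cball c R) W" "x \<in> cball c R" "\<And>y. y \<in> sphere c R \<Longrightarrow> W y < W x"
  obtains z d where "z \<in> ball c R" "d > 0" "ball z d \<subseteq> ball c R" "\<And>y. y \<in> ball c R \<Longrightarrow> W y \<le> W z"
proof -
  obtain z where z: "z \<in> cball c R" "\<And>y. y \<in> cball c R \<Longrightarrow> W y \<le> W z"
    using continuous_attains_sup[OF compact_cball _ assms(1)] assms(2) by blast
  have "z \<notin> sphere c R" using assms(3)[of z] z(2)[OF assms(2)] by auto
  then have "z \<in> ball c R" using z(1) by auto
  then show ?thesis using that z open_contains_ball[of "ball c R"] by (metis ball_subset_cball open_ball subsetD)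
qed

text \<open>A small multiple of |x - c|^2 makes the Laplacian strictly positive, which the second
  derivative test excludes at an interior maximum.\<close>

lemma subharmonic_polynomial_le:
  fixes c :: "'a::euclidean_space"
  assumes w: "real_polynomial_function w" and sub: "\<And>x. x \<in> ball c R \<Longrightarrow> laplacian w x \<ge> 0"
    and bd: "\<And>x. x \<in> sphere c R \<Longrightarrow> w x \<le> M" and x: "x \<in> cball c R"
  shows "w x \<le> M"
proof (rule field_le_epsilon)
  fix e :: real assume e: "e > 0"
  \<comment> \<open>On the sphere the added term is at most \<delta> R^2 < e; the summand 1 covers R
    = 0.\<close>
  define \<delta> where "\<delta> = e / (R\<^sup>2 + 1)"
  have \<delta>: "\<delta> > 0" using e by (simp add: \<delta>_def add_nonneg_pos)
  have \<delta>R: "\<delta> * R\<^sup>2 < e"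
  proof -
    have "\<delta> * (R\<^sup>2 + 1) = e" by (simp add: \<delta>_def add_nonneg_eq_0_iff)
    then show ?thesis using \<delta> by (simp add: ring_distribs)
  qed
  define W where "W = (\<lambda>x. w x + \<delta> * (norm (x - c))\<^sup>2)"
  have W: "real_polynomial_function W" unfolding W_def by (intro polynomial_intros w)
  have W_ge: "w y \<le> W y" for y using \<delta> by (simp add: W_def)
  show "w x \<le> M + e"
  proof (rule ccontr)
    assume "\<not> w x \<le> M + e"
    then have "W y < W x" if "y \<in> sphere c R" for y
      using bd[OF that] that W_ge[of x] \<delta>R by (auto simp: W_def dist_norm norm_minus_commute)
    then obtain z d where z: "z \<in> ball c R" "d > 0" "ball z d \<subseteq> ball c R"
        "\<And>y. y \<in> ball c R \<Longrightarrow> W y \<le> W z"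
      using continuous_attains_sup_ball_interior[of c R W x] x continuous_on_real_polynomial_function[OF W]
      by metis
    have "partial_deriv b (partial_deriv b W) z \<le> 0" if "b \<in> Basis" for b
      using z by (intro partial_deriv2_local_max[OF W z(2) _ that]) (auto simp: dist_commute subset_eq)
    then have "laplacian W z \<le> 0" unfolding laplacian_def by (rule sum_nonpos)
    moreover have "laplacian W z = laplacian w z + \<delta> * (2 * real DIM('a))"
      by (simp add: W_def laplacian_add laplacian_cmult laplacian_sq_dist polynomial_intros w)
    moreover have "\<delta> * (2 * real DIM('a)) > 0" using \<delta> by simp
    ultimately show False using sub[OF z(1)] by linarith
  qed
qed

text \<open>Bernstein's method: the maximum principle is applied to
  \<open>(R\<^sup>2 - \<bar>x - c\<bar>\<^sup>2)\<^sup>2 (\<partial>\<^sub>e h)\<^sup>2 + A h\<^sup>2\<close>, which is subharmonic for the chosen constant \<open>A\<close>.\<close>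

lemma harmonic_polynomial_gradient_bound:
  fixes c :: "'a::euclidean_space"
  assumes h: "harmonic_polynomial h" and R: "R > 0" and e: "e \<in> Basis"
    and bd: "\<And>x. x \<in> sphere c R \<Longrightarrow> \<bar>h x\<bar> \<le> K"
  shows "\<bar>partial_deriv e h c\<bar> \<le> sqrt (2 * real DIM('a) + 12) / R * K"
proof -
  let ?n = "real DIM('a)"
  define k where "k = partial_deriv e h"
  define \<phi> where "\<phi> = (\<lambda>x. R\<^sup>2 - (norm (x - c))\<^sup>2)"
  \<comment> \<open>This value makes 2A cancel the lower bound -(24 + 4n) R^2 for the coefficient of
    k^2 found below.\<close>
  define A where "A = (2 * ?n + 12) * R\<^sup>2"
  have p: "real_polynomial_function h" and lh: "\<And>x. laplacian h x = 0"
    using h by (auto simp: harmonic_polynomial_def)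
  have pk: "real_polynomial_function k" and lk: "\<And>x. laplacian k x = 0"
    using harmonic_polynomial_partial_deriv[OF h, of e] by (auto simp: harmonic_polynomial_def k_def)
  have p\<phi>: "real_polynomial_function \<phi>" unfolding \<phi>_def by (intro polynomial_intros)
  have d\<phi>: "partial_deriv b \<phi> = (\<lambda>x. - 2 * ((x - c) \<bullet> b))" for b
    by (simp add: \<phi>_def partial_deriv_diff polynomial_intros partial_deriv_sq_dist)
  have l\<phi>: "laplacian \<phi> x = - 2 * ?n" for x
    by (simp add: \<phi>_def laplacian_diff polynomial_intros laplacian_sq_dist)
  define w where "w = (\<lambda>x. (\<phi> x * \<phi> x) * (k x * k x) + A * (h x * h x))"
  have pw: "real_polynomial_function w" unfolding w_def by (intro polynomial_intros p\<phi> pk p)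
  have lap: "laplacian w x \<ge> 0" if x: "x \<in> ball c R" for x
  proof -
    have xR: "(norm (x - c))\<^sup>2 \<le> R\<^sup>2"
      using x by (intro power_mono) (auto simp: dist_norm norm_minus_commute)
    define N where "N = (norm (x - c))\<^sup>2"
    define y where "y b = (x - c) \<bullet> b" for b
    have N: "N = (\<Sum>b\<in>Basis. y b * y b)"
      by (simp add: N_def y_def power2_norm_eq_inner euclidean_inner[of "x-c" "x-c"])
    have 1: "laplacian (\<lambda>x. \<phi> x * \<phi> x) x = 8 * N - 4 * ?n * \<phi> x"
      by (simp add: laplacian_mult p\<phi> l\<phi> d\<phi> N sum_distrib_left mult_ac flip: y_def)
    have 2: "laplacian (\<lambda>x. k x * k x) x = 2 * (\<Sum>b\<in>Basis. partial_deriv b k x * partial_deriv b k x)"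
      by (simp add: laplacian_mult pk lk)
    have 3: "laplacian (\<lambda>x. h x * h x) x = 2 * (\<Sum>b\<in>Basis. partial_deriv b h x * partial_deriv b h x)"
      by (simp add: laplacian_mult p lh)
    \<comment> \<open>The function \<open>k\<close> is one component of the gradient of
      \<open>h\<close>, so the Laplacian of A h^2 contributes at least 2A k^2.\<close>
    have 4: "(\<Sum>b\<in>Basis. partial_deriv b h x * partial_deriv b h x) \<ge> k x * k x"
      unfolding k_def by (rule member_le_sum[OF e]) auto
    have 5: "(\<Sum>b\<in>Basis. partial_deriv b (\<lambda>x. \<phi> x * \<phi> x) x * partial_deriv b (\<lambda>x. k x * k x) x)
       = (\<Sum>b\<in>Basis. - 8 * \<phi> x * k x * ((x - c) \<bullet> b) * partial_deriv b k x)"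
      by (rule sum.cong) (auto simp: partial_deriv_mult p\<phi> pk d\<phi>)
    have 6: "(\<Sum>b\<in>Basis. - 8 * \<phi> x * k x * ((x - c) \<bullet> b) * partial_deriv b k x)
       = - 8 * (\<phi> x * k x * (\<Sum>b\<in>Basis. y b * partial_deriv b k x))"
      by (simp add: y_def sum_distrib_left mult.assoc sum_negf)
    \<comment> \<open>Completing the square absorbs the mixed term, whose sign is unknown. Twice
      this identity uses up 32 N k^2 while 8 N k^2 is available, hence the coefficient -24 N
      below.\<close>
    have 7: "(\<Sum>b\<in>Basis. (\<phi> x * partial_deriv b k x - 4 * k x * ((x - c) \<bullet> b))\<^sup>2)
       = \<phi> x * \<phi> x * (\<Sum>b\<in>Basis. partial_deriv b k x * partial_deriv b k x)
         - 8 * (\<phi> x * k x * (\<Sum>b\<in>Basis. y b * partial_deriv b k x)) + 16 * (k x * k x * N)"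
      unfolding y_def[symmetric]
      by (simp add: N power2_diff sum.distrib sum_subtractf sum_distrib_left power2_eq_square algebra_simps)
    have "laplacian w x = (\<phi> x * \<phi> x) * laplacian (\<lambda>x. k x * k x) x
        + (k x * k x) * laplacian (\<lambda>x. \<phi> x * \<phi> x) x
        + 2 * (\<Sum>b\<in>Basis. - 8 * \<phi> x * k x * ((x - c) \<bullet> b) * partial_deriv b k x)
        + A * laplacian (\<lambda>x. h x * h x) x"
      unfolding w_def 5[symmetric]
      by (simp add: laplacian_add laplacian_cmult
          laplacian_mult[of "\<lambda>x. \<phi> x * \<phi> x" "\<lambda>x. k x * k x"] polynomial_intros p\<phi> pk p)
    also have "\<dots> = 2 * (\<Sum>b\<in>Basis. (\<phi> x * partial_deriv b k x - 4 * k x * ((x - c) \<bullet> b))\<^sup>2)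
        + (k x * k x) * (- 24 * N - 4 * ?n * \<phi> x)
        + 2 * A * (\<Sum>b\<in>Basis. partial_deriv b h x * partial_deriv b h x)"
      unfolding 1 2 3 6 7 by (simp add: algebra_simps)
    also have "\<dots> \<ge> 0 + (k x * k x) * (- 24 * R\<^sup>2 - 4 * ?n * R\<^sup>2) + 2 * A * (k x * k x)"
    proof (intro add_mono)
      have "4 * ?n * \<phi> x \<le> 4 * ?n * R\<^sup>2"
        by (intro mult_left_mono) (auto simp: \<phi>_def)
      then have "- 24 * R\<^sup>2 - 4 * ?n * R\<^sup>2 \<le> - 24 * N - 4 * ?n * \<phi> x"
        using xR unfolding N_def by linarith
      then show "k x * k x * (- 24 * R\<^sup>2 - 4 * ?n * R\<^sup>2) \<le> k x * k x * (- 24 * N - 4 * ?n * \<phi> x)"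
        by (rule mult_left_mono) simp
      show "2 * A * (k x * k x) \<le> 2 * A * (\<Sum>b\<in>Basis. partial_deriv b h x * partial_deriv b h x)"
        using 4 by (intro mult_left_mono) (auto simp: A_def)
    qed (auto intro!: sum_nonneg)
    also have "0 + (k x * k x) * (- 24 * R\<^sup>2 - 4 * ?n * R\<^sup>2) + 2 * A * (k x * k x) = 0"
      by (simp add: A_def algebra_simps)
    finally show ?thesis by simp
  qed
  have bd2: "w x \<le> A * K\<^sup>2" if x: "x \<in> sphere c R" for x
  proof -
    have "\<phi> x = 0" using x by (simp add: \<phi>_def dist_norm norm_minus_commute)
    moreover have "h x * h x \<le> K\<^sup>2"
      using power_mono[OF bd[OF x], of 2] by (simp add: power2_eq_square)
    ultimately show ?thesis by (simp add: w_def A_def mult_left_mono)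
  qed
  have K: "K \<ge> 0"
  proof -
    have "c + R *\<^sub>R e \<in> sphere c R" using R e by (simp add: dist_norm)
    then show ?thesis using bd by force
  qed
  \<comment> \<open>At the centre \<phi> equals R^2, and on the sphere it vanishes: there
    \<open>w\<close> involves \<open>h\<close> only, which is what makes the boundary bound
    usable.\<close>
  have "(R * (R * k c))\<^sup>2 \<le> w c"
    by (simp add: w_def \<phi>_def A_def power2_eq_square)
  also have "w c \<le> A * K\<^sup>2"
    using R by (intro subharmonic_polynomial_le[OF pw lap bd2]) auto
  also have "A * K\<^sup>2 = (R * (sqrt (2 * ?n + 12) * K))\<^sup>2"
    by (simp add: A_def power_mult_distrib)
  finally have "\<bar>R * (R * k c)\<bar> \<le> \<bar>R * (sqrt (2 * ?n + 12) * K)\<bar>"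
    by (simp only: abs_le_square_iff)
  then show ?thesis
    using R K by (simp add: abs_mult k_def field_simps)
qed

section \<open>Locally uniform limits of harmonic polynomials\<close>

lemma harmonic_polynomials_deriv_limit:
  fixes h :: "nat \<Rightarrow> 'a::euclidean_space \<Rightarrow> real"
  assumes h: "\<And>n. harmonic_polynomial (h n)"
    and lim: "uniform_limit (cball z R) h F sequentially" and R: "R' < R" and b: "b \<in> Basis"
  shows "uniform_limit (cball z R') (\<lambda>n. partial_deriv b (h n)) (partial_deriv b F) sequentially"
    and "x \<in> cball z R' \<Longrightarrow> ((\<lambda>t. F (x + t *\<^sub>R b)) has_real_derivative partial_deriv b F x) (at 0)"
proof -
  \<comment> \<open>The gap between the radii is spent in two halves: one for the balls in the
    gradient estimate, the other for the segments along which the limit is differentiated.\<close>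
  define \<delta> where "\<delta> = (R - R') / 2"
  have \<delta>: "\<delta> > 0" using R by (simp add: \<delta>_def)
  define C where "C = sqrt (2 * real DIM('a) + 12) / \<delta>"
  have C: "C > 0" using \<delta> by (simp add: C_def)
  have sub: "cball y \<delta> \<subseteq> cball z R" if "y \<in> cball z (R' + \<delta>)" for y
    using that by (auto simp: \<delta>_def cball_subset_cball_iff dist_commute field_simps)
  \<comment> \<open>The gradient estimate is linear in the bound, so applied to
    \<open>h m - h n\<close> it turns uniform closeness of the functions into uniform closeness of
    their derivatives.\<close>
  have "uniformly_Cauchy_on (cball z (R' + \<delta>)) (\<lambda>n. partial_deriv b (h n))"
    unfolding uniformly_Cauchy_on_def
  proof (intro allI impI)
    fix e :: real assume e: "e > 0"
    have "uniformly_Cauchy_on (cball z R) h"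
      using lim uniformly_convergent_Cauchy uniformly_convergent_on_def by blast
    then obtain M where M: "\<And>y m n. y \<in> cball z R \<Longrightarrow> m \<ge> M \<Longrightarrow> n \<ge> M \<Longrightarrow> dist (h m y) (h n y) < e / (2 * C)"
      unfolding uniformly_Cauchy_on_def using e C by (meson divide_pos_pos mult_pos_pos zero_less_numeral)
    have "dist (partial_deriv b (h m) y) (partial_deriv b (h n) y) < e"
      if y: "y \<in> cball z (R' + \<delta>)" and mn: "m \<ge> M" "n \<ge> M" for y m n
    proof -
      have "\<bar>partial_deriv b (\<lambda>x. h m x - h n x) y\<bar> \<le> C * (e / (2 * C))"
        unfolding C_def
      proof (rule harmonic_polynomial_gradient_bound[OF harmonic_polynomial_diff[OF h h] \<delta> b])
        fix x assume "x \<in> sphere y \<delta>"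
        then have "x \<in> cball z R" using sub[OF y] by auto
        then show "\<bar>h m x - h n x\<bar> \<le> e / (2 * (sqrt (2 * real DIM('a) + 12) / \<delta>))"
          using M[of x m n] mn by (simp add: dist_norm C_def)
      qed
      then show ?thesis using C e h
        by (simp add: partial_deriv_diff harmonic_polynomial_def dist_norm)
    qed
    then show "\<exists>M. \<forall>x\<in>cball z (R' + \<delta>). \<forall>m\<ge>M. \<forall>n\<ge>M.
        dist (partial_deriv b (h m) x) (partial_deriv b (h n) x) < e" by blast
  qed
  then obtain G where G: "uniform_limit (cball z (R' + \<delta>)) (\<lambda>n. partial_deriv b (h n)) G sequentially"
    using uniformly_convergent_eq_Cauchy uniformly_convergent_on_def by blast
  have der: "((\<lambda>t. F (x + t *\<^sub>R b)) has_real_derivative G x) (at 0)" if x: "x \<in> cball z R'" for x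
  proof -
    let ?S = "{-\<delta>..\<delta>}"
    have mem: "x + t *\<^sub>R b \<in> cball z (R' + \<delta>)" if "t \<in> ?S" for t
    proof -
      have "dist (x + t *\<^sub>R b) x \<le> \<delta>" using that b by (simp add: dist_norm abs_le_iff)
      then show ?thesis using x dist_triangle[of z "x + t *\<^sub>R b" x] by (simp add: dist_commute)
    qed
    have F_lim: "(\<lambda>n. h n y) \<longlonglongrightarrow> F y" if "y \<in> cball z (R' + \<delta>)" for y
      using tendsto_uniform_limitI[OF lim] sub[OF that] \<delta> by (meson centre_in_cball less_imp_le subsetD)
    have "\<exists>g. \<forall>t\<in>?S. (\<lambda>n. h n (x + t *\<^sub>R b)) \<longlonglongrightarrow> g t \<and>
        (g has_derivative (*) (G (x + t *\<^sub>R b))) (at t within ?S)"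
    proof (rule has_derivative_sequence[where f' = "\<lambda>n t. (*) (partial_deriv b (h n) (x + t *\<^sub>R b))"])
      show "((\<lambda>t. h n (x + t *\<^sub>R b)) has_derivative (*) (partial_deriv b (h n) (x + t *\<^sub>R b))) (at t within ?S)" for n t
        using has_partial_deriv_poly_at[of "h n" x b t] h[of n]
        by (simp add: harmonic_polynomial_def has_field_derivative_def has_derivative_at_withinI)
      show "(\<lambda>n. h n (x + 0 *\<^sub>R b)) \<longlonglongrightarrow> F (x + 0 *\<^sub>R b)"
        by (rule F_lim, rule mem) (use \<delta> in auto)
      fix e :: real assume "e > 0"
      with G have "\<forall>\<^sub>F n in sequentially. \<forall>y\<in>cball z (R' + \<delta>). dist (partial_deriv b (h n) y) (G y) < e"
        by (simp add: uniform_limit_iff)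
      then show "\<forall>\<^sub>F n in sequentially. \<forall>t\<in>?S. \<forall>s. norm (partial_deriv b (h n) (x + t *\<^sub>R b) * s
          - G (x + t *\<^sub>R b) * s) \<le> e * norm s"
      proof eventually_elim
        case (elim n)
        show ?case
        proof (intro ballI allI)
          fix t s :: real assume "t \<in> ?S"
          then have "\<bar>partial_deriv b (h n) (x + t *\<^sub>R b) - G (x + t *\<^sub>R b)\<bar> \<le> e"
            using elim mem by (force simp: dist_norm)
          then show "norm (partial_deriv b (h n) (x + t *\<^sub>R b) * s - G (x + t *\<^sub>R b) * s) \<le> e * norm s"
            by (simp add: abs_mult mult_right_mono flip: left_diff_distrib)
        qed
      qed
    qed (use \<delta> in auto)
    then obtain g where g: "\<And>t. t \<in> ?S \<Longrightarrow> (\<lambda>n. h n (x + t *\<^sub>R b)) \<longlonglongrightarrow> g t"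
      "\<And>t. t \<in> ?S \<Longrightarrow> (g has_derivative (*) (G (x + t *\<^sub>R b))) (at t within ?S)" by blast
    \<comment> \<open>The theorem on derivatives of sequences only provides some limit function;
      uniqueness of limits identifies it with \<open>F\<close> on the segment.\<close>
    have gF: "g t = F (x + t *\<^sub>R b)" if "t \<in> ?S" for t
      using LIMSEQ_unique[OF g(1)[OF that] F_lim[OF mem[OF that]]] .
    have "(g has_real_derivative G x) (at 0 within ?S)"
      using g(2)[of 0] \<delta> by (simp add: has_field_derivative_def)
    then have "((\<lambda>t. F (x + t *\<^sub>R b)) has_real_derivative G x) (at 0 within ?S)"
      by (rule has_field_derivative_transform_within[OF _ \<delta>]) (use \<delta> gF in auto)
    moreover have "at 0 within ?S = at (0::real)"
      by (rule at_within_interior) (use \<delta> in \<open>simp add: interior_atLeastAtMost_real\<close>)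
    ultimately show ?thesis by simp
  qed
  have eq: "partial_deriv b F x = G x" if "x \<in> cball z R'" for x
    using der[OF that] by (simp add: partial_deriv_def DERIV_imp_deriv)
  have "uniform_limit (cball z R') (\<lambda>n. partial_deriv b (h n)) G sequentially"
    by (rule uniform_limit_on_subset[OF G]) (use \<delta> in auto)
  then show "uniform_limit (cball z R') (\<lambda>n. partial_deriv b (h n)) (partial_deriv b F) sequentially"
    by (subst uniform_limit_cong'[where g = "\<lambda>n. partial_deriv b (h n)" and i = G]) (use eq in auto)
  show "x \<in> cball z R' \<Longrightarrow> ((\<lambda>t. F (x + t *\<^sub>R b)) has_real_derivative partial_deriv b F x) (at 0)"
    using der eq by simp
qed

lemma harmonic_polynomials_limit_harmonic:
  fixes h :: "nat \<Rightarrow> 'a::euclidean_space \<Rightarrow> real"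
  assumes h: "\<And>n. harmonic_polynomial (h n)"
    and lim: "uniform_limit (cball z R) h F sequentially" and R: "R' < R"
  shows "C_diff_on 2 F (ball z R')" "x \<in> ball z R' \<Longrightarrow> laplacian F x = 0"
proof -
  \<comment> \<open>Each differentiation costs some radius, and two derivatives are needed.\<close>
  define R1 where "R1 = (R + R') / 2"
  have R1: "R1 < R" "R' < R1" using R by (auto simp: R1_def)
  have cont: "continuous_on (cball z r) G"
    if "\<And>n. harmonic_polynomial (g n)" "uniform_limit (cball z r) g G sequentially" for g G r
    by (rule uniform_limit_theorem[OF _ that(2)])
      (use that(1) in \<open>auto simp: harmonic_polynomial_def intro!: always_eventually continuous_on_real_polynomial_function\<close>)
  have h1: "\<And>n. harmonic_polynomial (partial_deriv b (h n))" for b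
    by (rule harmonic_polynomial_partial_deriv[OF h])
  have h2: "\<And>n. harmonic_polynomial (partial_deriv b (partial_deriv a (h n)))" for a b
    by (rule harmonic_polynomial_partial_deriv[OF h1])
  note d1 = harmonic_polynomials_deriv_limit[OF h lim R1(1)]
  note d2 = harmonic_polynomials_deriv_limit[OF h1 d1(1) R1(2)]
  have sub: "ball z R' \<subseteq> cball z R" "ball z R' \<subseteq> cball z R1" "ball z R' \<subseteq> cball z R'"
    using R1 by auto
  show "C_diff_on 2 F (ball z R')"
    unfolding numeral_2_eq_2 C_diff_on.simps
  proof (intro conjI ballI)
    show "continuous_on (ball z R') F"
      by (rule continuous_on_subset[OF cont[OF h lim] sub(1)])
    fix b :: 'a assume b: "b \<in> Basis"
    show "continuous_on (ball z R') (partial_deriv b F)"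
      by (rule continuous_on_subset[OF cont[OF h1 d1(1)[OF b]] sub(2)])
    show "(\<lambda>t. F (x + t *\<^sub>R b)) field_differentiable at 0" if "x \<in> ball z R'" for x
      using d1(2)[OF b] that sub(2) by (meson field_differentiable_def subsetD)
    fix a :: 'a assume a: "a \<in> Basis"
    show "continuous_on (ball z R') (partial_deriv a (partial_deriv b F))"
      by (rule continuous_on_subset[OF cont[OF h2 d2(1)[OF b a]] sub(3)])
    show "(\<lambda>t. partial_deriv b F (x + t *\<^sub>R a)) field_differentiable at 0" if "x \<in> ball z R'" for x
      using d2(2)[OF b a] that sub(3) by (meson field_differentiable_def subsetD)
  qed
  assume x: "x \<in> ball z R'"
  have "(\<lambda>n. laplacian (h n) x) \<longlonglongrightarrow> laplacian F x"
    unfolding laplacian_def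
    using tendsto_uniform_limitI[OF d2(1)] x by (intro tendsto_sum) auto
  moreover have "(\<lambda>n. laplacian (h n) x) = (\<lambda>n. 0)"
    using h by (simp add: harmonic_polynomial_def)
  ultimately show "laplacian F x = 0" by (metis LIMSEQ_const_iff)
qed

subsection \<open>Sphere integrals of polynomials\<close>

text \<open>The reflection is a diagonal map with entries 1 and a single -1, so its Jacobian factor
  is 1. It serves to annihilate the moments on spheres that are odd in one coordinate.\<close>

lemma distr_lborel_reflection:
  fixes i :: "'a::euclidean_space"
  assumes i: "i \<in> Basis"
  shows "distr lborel borel (\<lambda>y. y - (2 * (y \<bullet> i)) *\<^sub>R i) = lborel"
proof -
  define c where "c = (\<lambda>j. if j = i then - 1 else (1::real))"
  have "(\<lambda>y. 0 + (\<Sum>j\<in>Basis. (c j * (y \<bullet> j)) *\<^sub>R j)) = (\<lambda>y. y - (2 * (y \<bullet> i)) *\<^sub>R i)"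
  proof (rule ext, rule euclidean_eqI)
    fix y b :: 'a assume b: "b \<in> Basis"
    have "(0 + (\<Sum>j\<in>Basis. (c j * (y \<bullet> j)) *\<^sub>R j)) \<bullet> b = c b * (y \<bullet> b)"
      using b by simp
    also have "\<dots> = (y - (2 * (y \<bullet> i)) *\<^sub>R i) \<bullet> b"
      using b i by (simp add: c_def inner_diff_left inner_Basis)
    finally show "(0 + (\<Sum>j\<in>Basis. (c j * (y \<bullet> j)) *\<^sub>R j)) \<bullet> b = (y - (2 * (y \<bullet> i)) *\<^sub>R i) \<bullet> b" .
  qed
  moreover have "(\<Prod>j\<in>Basis. \<bar>c j\<bar>) = 1" by (intro prod.neutral) (auto simp: c_def)
  ultimately show ?thesis
    using lborel_affine_euclidean[of c 0] by (simp add: density_1) (simp add: c_def)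
qed

text \<open>Since |i - j|^2 = 2, this is the reflection that exchanges the coordinates
  \<open>i\<close> and \<open>j\<close>. It pulls boxes back to boxes with two sides exchanged. It
  serves to equate the second moments on spheres.\<close>

lemma distr_lborel_swap:
  fixes i j :: "'a::euclidean_space"
  assumes i: "i \<in> Basis" and j: "j \<in> Basis" and ij: "i \<noteq> j"
  shows "distr lborel borel (\<lambda>y. y - (y \<bullet> (i - j)) *\<^sub>R (i - j)) = lborel"
proof (rule sym, rule lborel_eqI)
  let ?L = "\<lambda>y. y - (y \<bullet> (i - j)) *\<^sub>R (i - j)"
  define \<pi> where "\<pi> b = (if b = i then j else if b = j then i else b)" for b
  have L: "?L y \<bullet> b = y \<bullet> \<pi> b" if "b \<in> Basis" for y b
    using that i j ij by (auto simp: \<pi>_def inner_Basis inner_diff_left inner_diff_right algebra_simps)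
  have \<pi>: "\<pi> b \<in> Basis" "\<pi> (\<pi> b) = b" if "b \<in> Basis" for b
    using that i j by (auto simp: \<pi>_def)
  have bij: "bij_betw \<pi> Basis Basis"
    by (rule bij_betw_byWitness[where f' = \<pi>]) (use \<pi> in auto)
  have meas: "?L \<in> borel_measurable borel" by measurable
  fix l u :: 'a assume lu: "\<And>b. b \<in> Basis \<Longrightarrow> l \<bullet> b \<le> u \<bullet> b"
  have "y \<in> ?L -` box l u \<longleftrightarrow> y \<in> box (?L l) (?L u)" for y
  proof -
    have "y \<in> ?L -` box l u \<longleftrightarrow> (\<forall>b\<in>Basis. l \<bullet> b < y \<bullet> \<pi> b \<and> y \<bullet> \<pi> b < u \<bullet> b)"
      using L by (simp add: mem_box)
    also have "\<dots> \<longleftrightarrow> (\<forall>b\<in>Basis. l \<bullet> \<pi> b < y \<bullet> b \<and> y \<bullet> b < u \<bullet> \<pi> b)"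
      using \<pi> by metis
    also have "\<dots> \<longleftrightarrow> y \<in> box (?L l) (?L u)"
      using L by (simp add: mem_box)
    finally show ?thesis .
  qed
  then have "?L -` box l u = box (?L l) (?L u)" by blast
  then have "emeasure (distr lborel borel ?L) (box l u) = emeasure lborel (box (?L l) (?L u))"
    by (simp add: emeasure_distr meas)
  also have "\<dots> = (\<Prod>b\<in>Basis. (?L u - ?L l) \<bullet> b)"
    by (rule emeasure_lborel_box) (use L lu \<pi> in simp)
  also have "(\<Prod>b\<in>Basis. (?L u - ?L l) \<bullet> b) = (\<Prod>b\<in>Basis. (u - l) \<bullet> \<pi> b)"
    by (rule prod.cong) (use L in \<open>auto simp only: inner_diff_left\<close>)
  also have "\<dots> = (\<Prod>b\<in>Basis. (u - l) \<bullet> b)"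
    by (rule prod.reindex_bij_betw[OF bij])
  finally show "emeasure (distr lborel borel ?L) (box l u) = (\<Prod>b\<in>Basis. (u - l) \<bullet> b)" .
qed simp

text \<open>A linear isometry about \<open>x\<close> preserves the ball and commutes with the radial
  projection, so invariance of Lebesgue measure passes to the sphere.\<close>

lemma distr_sphere_measure:
  fixes x :: "'a::euclidean_space"
  assumes lin: "linear L" and iso: "\<And>y. norm (L y) = norm y" and L: "distr lborel borel L = lborel"
  shows "distr (sphere_measure x r) borel (\<lambda>y. x + L (y - x)) = sphere_measure x r"
proof (rule measure_eqI)
  interpret L: linear L by fact
  let ?T = "\<lambda>y. x + L (y - x)"
  have [measurable]: "L \<in> borel_measurable borel"
    using lin by (intro borel_measurable_continuous_onI linear_continuous_on) (simp add: linear_linear)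
  have T [measurable]: "?T \<in> borel_measurable borel" by measurable
  have "distr lborel borel ?T = distr (distr (distr lborel borel ((+) (- x))) borel L) borel ((+) x)"
    by (subst distr_distr, measurable) (subst distr_distr, measurable, simp add: comp_def)
  then have dT: "distr lborel borel ?T = lborel" by (simp add: lborel_distr_plus L)
  fix A assume "A \<in> sets (distr (sphere_measure x r) borel ?T)"
  then have A [measurable]: "A \<in> sets borel" by simp
  have TA: "?T -` A \<in> sets borel" using measurable_sets[OF T A] by simp
  have pA: "radial_proj x r -` A \<inter> ball x r \<in> sets borel"
    using measurable_sets[OF radial_proj_measurable A, of x r] by simp
  have "radial_proj x r -` ?T -` A \<inter> ball x r = ?T -` (radial_proj x r -` A \<inter> ball x r)"
    by (auto simp: radial_proj_def dist_norm iso L.scaleR norm_minus_commute)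
  then have "emeasure (sphere_measure x r) (?T -` A) =
      ennreal (real DIM('a) / r) * emeasure (distr lborel borel ?T) (radial_proj x r -` A \<inter> ball x r)"
    by (simp add: emeasure_sphere_measure_aux TA emeasure_distr pA)
  then show "emeasure (distr (sphere_measure x r) borel ?T) A = emeasure (sphere_measure x r) A"
    by (simp add: emeasure_distr emeasure_sphere_measure_aux A dT)
qed simp

lemma set_integral_sphere_isometry:
  fixes x :: "'a::euclidean_space" and f :: "'a \<Rightarrow> real"
  assumes lin: "linear L" and iso: "\<And>y. norm (L y) = norm y" and L: "distr lborel borel L = lborel"
    and f [measurable]: "f \<in> borel_measurable borel"
  shows "(LINT y:sphere x r|sphere_measure x r. f (x + L (y - x))) = (LINT y:sphere x r|sphere_measure x r. f y)"
proof -
  have [measurable]: "L \<in> borel_measurable borel"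
    using lin by (intro borel_measurable_continuous_onI linear_continuous_on) (simp add: linear_linear)
  have ind: "indicator (sphere x r) (x + L (y - x)) = (indicator (sphere x r) y :: real)" for y
    by (auto simp: indicator_def dist_norm iso norm_minus_commute)
  have "(LINT y:sphere x r|sphere_measure x r. f y)
      = (LINT y:sphere x r|distr (sphere_measure x r) borel (\<lambda>y. x + L (y - x)). f y)"
    by (simp add: distr_sphere_measure[OF lin iso L])
  also have "\<dots> = (LINT y:sphere x r|sphere_measure x r. f (x + L (y - x)))"
  proof -
    have "(\<lambda>y. x + L (y - x)) \<in> sphere_measure x r \<rightarrow>\<^sub>M borel" by measurable
    moreover have "(\<lambda>y. indicat_real (sphere x r) y *\<^sub>R f y) \<in> borel_measurable borel"
      by (intro borel_measurable_scaleR borel_measurable_indicator f) simp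
    ultimately show ?thesis
      unfolding set_lebesgue_integral_def by (simp add: integral_distr ind)
  qed
  finally show ?thesis by simp
qed

section \<open>Integrability and moments up to order two on spheres\<close>

lemma sphere_area_pos: "r > 0 \<Longrightarrow> m > 0 \<Longrightarrow> sphere_area m r > 0"
  by (simp add: sphere_area_def Gamma_real_pos)

lemma finite_measure_sphere_measure: "finite_measure (sphere_measure (x::'a::euclidean_space) r)"
proof (rule finite_measureI)
  have "emeasure lborel (ball x r) < \<infinity>" by (rule emeasure_bounded_finite) simp
  then show "emeasure (sphere_measure x r) (space (sphere_measure x r)) \<noteq> \<infinity>"
    by (simp add: emeasure_sphere_measure_aux ennreal_mult_eq_top_iff)
qed

lemma set_integrable_sphere_measure:
  fixes x :: "'a::euclidean_space" and f :: "'a \<Rightarrow> real"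
  assumes f: "continuous_on (sphere x r) f"
  shows "set_integrable (sphere_measure x r) (sphere x r) f"
proof -
  interpret finite_measure "sphere_measure x r" by (rule finite_measure_sphere_measure)
  obtain B where B: "\<And>y. y \<in> sphere x r \<Longrightarrow> norm (f y) \<le> B"
    using compact_imp_bounded[OF compact_continuous_image[OF f compact_sphere]]
    unfolding bounded_iff by blast
  show ?thesis unfolding set_integrable_def
  proof (rule integrable_const_bound[where B = "max B 0"])
    show "AE y in sphere_measure x r. norm (indicat_real (sphere x r) y *\<^sub>R f y) \<le> max B 0"
      using B by (auto simp: indicator_def le_max_iff_disj)
    have "(\<lambda>y. indicat_real (sphere x r) y *\<^sub>R f y) \<in> borel_measurable borel"
      by (rule borel_measurable_continuous_on_indicator[OF _ f]) simp
    then show "(\<lambda>y. indicat_real (sphere x r) y *\<^sub>R f y) \<in> borel_measurable (sphere_measure x r)"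
      by simp
  qed
qed

lemma set_integral_sphere_const:
  fixes x :: "'a::euclidean_space"
  assumes "r > 0"
  shows "(LINT y:sphere x r|sphere_measure x r. a) = sphere_area DIM('a) r * (a::real)"
proof -
  have "measure (sphere_measure x r) (sphere x r) = sphere_area DIM('a) r"
    using emeasure_sphere_measure_sphere[OF assms, of x] sphere_area_pos[OF assms, of "DIM('a)"]
    by (simp add: measure_def)
  then show ?thesis
    using emeasure_sphere_measure_sphere[OF assms, of x]
    by (simp add: set_lebesgue_integral_def)
qed

lemma set_integral_sphere_sum:
  fixes x :: "'a::euclidean_space" and f :: "'i \<Rightarrow> 'a \<Rightarrow> real"
  assumes "\<And>i. i \<in> I \<Longrightarrow> continuous_on (sphere x r) (f i)"
  shows "(LINT y:sphere x r|sphere_measure x r. (\<Sum>i\<in>I. f i y)) = (\<Sum>i\<in>I. LINT y:sphere x r|sphere_measure x r. f i y)"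
  using set_integrable_sphere_measure[OF assms]
  unfolding set_lebesgue_integral_def set_integrable_def scaleR_sum_right
  by (intro Bochner_Integration.integral_sum)

lemma linear_reflection: "linear (\<lambda>y::'a::real_inner. y - (a * (y \<bullet> i)) *\<^sub>R i)"
  by (rule linearI) (simp_all add: algebra_simps inner_add_left)

text \<open>The normalisation covers both symmetries in use: \<open>a = 2\<close> with a basis
  vector and \<open>a = 1\<close> with a difference of two basis vectors.\<close>

lemma norm_reflection:
  fixes i :: "'a::real_inner"
  assumes "a * (i \<bullet> i) = 2"
  shows "norm (y - (a * (y \<bullet> i)) *\<^sub>R i) = norm y"
proof -
  have "(y - (a * (y \<bullet> i)) *\<^sub>R i) \<bullet> (y - (a * (y \<bullet> i)) *\<^sub>R i)
     = y \<bullet> y - 2 * a * (y \<bullet> i)\<^sup>2 + a * (y \<bullet> i)\<^sup>2 * (a * (i \<bullet> i))"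
    by (simp only: inner_diff_left inner_diff_right inner_scaleR_left inner_scaleR_right inner_commute[of i y])
      (simp add: power2_eq_square algebra_simps)
  also have "\<dots> = y \<bullet> y" unfolding assms by simp
  finally show ?thesis by (simp add: norm_eq)
qed

text \<open>Both integrands change sign under the reflection of the coordinate \<open>b\<close>, so
  each integral equals its own negative.\<close>

lemma set_integral_sphere_coord:
  fixes x :: "'a::euclidean_space"
  assumes b: "b \<in> Basis"
  shows "(LINT y:sphere x r|sphere_measure x r. (y - x) \<bullet> b) = 0"
    and "c \<in> Basis \<Longrightarrow> c \<noteq> b \<Longrightarrow> (LINT y:sphere x r|sphere_measure x r. ((y - x) \<bullet> b) * ((y - x) \<bullet> c)) = 0"
proof -
  let ?L = "\<lambda>y. y - (2 * (y \<bullet> b)) *\<^sub>R b"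
  have n: "norm (?L y) = norm y" for y by (rule norm_reflection) (use b in simp)
  note refl = set_integral_sphere_isometry[OF linear_reflection n distr_lborel_reflection[OF b], where x = x and r = r]
  have "(LINT y:sphere x r|sphere_measure x r. - ((y - x) \<bullet> b)) = (LINT y:sphere x r|sphere_measure x r. (y - x) \<bullet> b)"
    using refl[of "\<lambda>y. (y - x) \<bullet> b"] b by (simp add: inner_diff_left[of _ _ b] algebra_simps)
  then show "(LINT y:sphere x r|sphere_measure x r. (y - x) \<bullet> b) = 0"
    by (simp add: set_lebesgue_integral_def)
  assume c: "c \<in> Basis" "c \<noteq> b"
  have "(LINT y:sphere x r|sphere_measure x r. - (((y - x) \<bullet> b) * ((y - x) \<bullet> c)))
     = (LINT y:sphere x r|sphere_measure x r. ((y - x) \<bullet> b) * ((y - x) \<bullet> c))"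
    using refl[of "\<lambda>y. ((y - x) \<bullet> b) * ((y - x) \<bullet> c)"] b c by (simp add: inner_simps inner_Basis algebra_simps)
  then show "(LINT y:sphere x r|sphere_measure x r. ((y - x) \<bullet> b) * ((y - x) \<bullet> c)) = 0"
    by (simp add: set_lebesgue_integral_def)
qed

text \<open>Exchanging coordinates makes all second moments equal, and their sum is the integral of
  the constant r^2.\<close>

lemma set_integral_sphere_coord_sq:
  fixes x :: "'a::euclidean_space"
  assumes b: "b \<in> Basis" and r: "r > 0"
  shows "(LINT y:sphere x r|sphere_measure x r. ((y - x) \<bullet> b) * ((y - x) \<bullet> b))
    = sphere_area DIM('a) r * (r\<^sup>2 / real DIM('a))"
proof -
  define I where "I c = (LINT y:sphere x r|sphere_measure x r. ((y - x) \<bullet> c) * ((y - x) \<bullet> c))" for c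
  have eq: "I c = I b" if c: "c \<in> Basis" for c
  proof (cases "c = b")
    case False
    let ?L = "\<lambda>y. y - (1 * (y \<bullet> (b - c))) *\<^sub>R (b - c)"
    have n: "norm (?L y) = norm y" for y
      by (rule norm_reflection) (use b c False in \<open>simp add: inner_diff_left inner_diff_right inner_Basis\<close>)
    have d: "distr lborel borel ?L = lborel" using distr_lborel_swap[OF b c] False by simp
    show ?thesis
      using set_integral_sphere_isometry[OF linear_reflection n d, where x = x and r = r and f = "\<lambda>y. ((y - x) \<bullet> c) * ((y - x) \<bullet> c)"]
        b c False by (simp add: I_def inner_simps inner_Basis algebra_simps)
  qed simp
  have "real DIM('a) * I b = (\<Sum>c\<in>Basis. I c)" using eq by simp
  also have "\<dots> = (LINT y:sphere x r|sphere_measure x r. (\<Sum>c\<in>Basis. ((y - x) \<bullet> c) * ((y - x) \<bullet> c)))"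
    unfolding I_def by (rule set_integral_sphere_sum[symmetric]) (intro continuous_intros)
  also have "\<dots> = (LINT y:sphere x r|sphere_measure x r. r\<^sup>2)"
    by (rule set_lebesgue_integral_cong)
      (auto simp: dist_norm norm_minus_commute power2_norm_eq_inner euclidean_inner[of "_ - x" "_ - x", symmetric])
  also have "\<dots> = sphere_area DIM('a) r * r\<^sup>2" by (rule set_integral_sphere_const[OF r])
  finally show ?thesis unfolding I_def by (simp add: field_simps)
qed

lemma polynomial_taylor2_le:
  fixes q :: "'a::euclidean_space \<Rightarrow> real"
  assumes q: "real_polynomial_function q" and \<eta>: "\<eta> > 0"
  shows "\<exists>d>0. \<forall>h. norm h < d \<longrightarrow>
    q (x + h) \<le> q x + (\<Sum>b\<in>Basis. (h \<bullet> b) * partial_deriv b q x)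
      + (\<Sum>b\<in>Basis. \<Sum>c\<in>Basis. (h \<bullet> b) * (h \<bullet> c) * partial_deriv b (partial_deriv c q) x) / 2 + \<eta> * (norm h)\<^sup>2"
proof -
  define H where "H b c = partial_deriv b (partial_deriv c q)" for b c
  have pH: "real_polynomial_function (H b c)" for b c
    unfolding H_def by (intro polynomial_intros q)
  let ?n = "real DIM('a)"
  \<comment> \<open>There are n^2 entries of the Hessian, each costing at most \<epsilon> |h|^2, and
    Taylor's formula halves the total, leaving exactly \<eta> |h|^2.\<close>
  define \<epsilon> where "\<epsilon> = 2 * \<eta> / ?n\<^sup>2"
  have \<epsilon>: "\<epsilon> > 0" using \<eta> by (simp add: \<epsilon>_def)
  have "\<forall>\<^sub>F z in nhds x. \<forall>b\<in>Basis. \<forall>c\<in>Basis. dist (H b c z) (H b c x) < \<epsilon>"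
  proof (intro eventually_ball_finite finite_Basis ballI)
    fix b c
    have "isCont (H b c) x" using continuous_real_polymonial_function[OF pH] .
    then have "(H b c \<longlongrightarrow> H b c x) (nhds x)" by (simp add: isCont_def tendsto_at_iff_tendsto_nhds)
    then show "\<forall>\<^sub>F z in nhds x. dist (H b c z) (H b c x) < \<epsilon>" using \<epsilon> by (rule tendstoD)
  qed
  then obtain d where d: "d > 0" "\<And>z b c. dist z x < d \<Longrightarrow> b \<in> Basis \<Longrightarrow> c \<in> Basis \<Longrightarrow> \<bar>H b c z - H b c x\<bar> < \<epsilon>"
    unfolding eventually_nhds_metric dist_real_def by metis
  have "q (x + h) \<le> q x + (\<Sum>b\<in>Basis. (h \<bullet> b) * partial_deriv b q x)
      + (\<Sum>b\<in>Basis. \<Sum>c\<in>Basis. (h \<bullet> b) * (h \<bullet> c) * H b c x) / 2 + \<eta> * (norm h)\<^sup>2" if h: "norm h < d" for h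
  proof -
    have ph: "partial_deriv h q = (\<lambda>z. \<Sum>c\<in>Basis. (h \<bullet> c) * partial_deriv c q z)"
      by (rule ext) (rule partial_deriv_Basis_expansion[OF q])
    have phh: "partial_deriv h (partial_deriv h q) z = (\<Sum>b\<in>Basis. \<Sum>c\<in>Basis. (h \<bullet> b) * (h \<bullet> c) * H b c z)" for z
    proof -
      have 1: "partial_deriv h (partial_deriv h q) z = (\<Sum>b\<in>Basis. (h \<bullet> b) * partial_deriv b (partial_deriv h q) z)"
        by (rule partial_deriv_Basis_expansion) (intro polynomial_intros q)
      have 2: "partial_deriv b (partial_deriv h q) z = (\<Sum>c\<in>Basis. (h \<bullet> c) * H b c z)" for b
        unfolding ph H_def by (simp add: partial_deriv_sum partial_deriv_cmult polynomial_intros q)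
      show ?thesis unfolding 1 by (simp add: 2 sum_distrib_left mult.assoc)
    qed
    define diff where "diff m t = (if m = 0 then q (x + t *\<^sub>R h) else if m = 1 then partial_deriv h q (x + t *\<^sub>R h)
      else partial_deriv h (partial_deriv h q) (x + t *\<^sub>R h))" for m :: nat and t
    have "\<exists>t::real. 0 < t \<and> t < 1 \<and> q (x + 1 *\<^sub>R h)
       = (\<Sum>m<2. (diff m 0 / fact m) * (1 - 0)^m) + (diff 2 t / fact 2) * (1 - 0)^2"
    proof (rule Taylor_up[where f = "\<lambda>t. q (x + t *\<^sub>R h)"])
      show "\<forall>m t. m < 2 \<and> 0 \<le> t \<and> t \<le> 1 \<longrightarrow> (diff m has_real_derivative diff (Suc m) t) (at t)"
        using has_partial_deriv_poly_at[OF q] has_partial_deriv_poly_at[OF real_polynomial_function_partial_deriv[OF q]]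
        by (auto simp: diff_def[abs_def] less_2_cases_iff)
    qed (auto simp: diff_def)
    then obtain t where t: "0 < t" "t < 1" and tay: "q (x + h) = q x + partial_deriv h q x
        + partial_deriv h (partial_deriv h q) (x + t *\<^sub>R h) / 2"
      by (auto simp: diff_def numeral_2_eq_2)
    have "dist (x + t *\<^sub>R h) x < d"
    proof -
      have "t * norm h \<le> norm h" using t by (simp add: mult_left_le_one_le)
      then show ?thesis using h t by (simp add: dist_norm)
    qed
    note dH = d(2)[OF this]
    have "(\<Sum>b\<in>Basis. \<Sum>c\<in>Basis. (h \<bullet> b) * (h \<bullet> c) * H b c (x + t *\<^sub>R h))
       \<le> (\<Sum>b\<in>Basis. \<Sum>c\<in>Basis. (h \<bullet> b) * (h \<bullet> c) * H b c x + (norm h)\<^sup>2 * \<epsilon>)"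
    proof (intro sum_mono)
      fix b c :: 'a assume b: "b \<in> Basis" and c: "c \<in> Basis"
      have "(h \<bullet> b) * (h \<bullet> c) * (H b c (x + t *\<^sub>R h) - H b c x) \<le> \<bar>(h \<bullet> b) * (h \<bullet> c) * (H b c (x + t *\<^sub>R h) - H b c x)\<bar>"
        by simp
      also have "\<dots> = \<bar>h \<bullet> b\<bar> * \<bar>h \<bullet> c\<bar> * \<bar>H b c (x + t *\<^sub>R h) - H b c x\<bar>" by (simp add: abs_mult)
      also have "\<dots> \<le> norm h * norm h * \<epsilon>"
        using Basis_le_norm[OF b, of h] Basis_le_norm[OF c, of h] dH[OF b c]
        by (intro mult_mono) auto
      finally show "(h \<bullet> b) * (h \<bullet> c) * H b c (x + t *\<^sub>R h) \<le> (h \<bullet> b) * (h \<bullet> c) * H b c x + (norm h)\<^sup>2 * \<epsilon>"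
        by (simp add: power2_eq_square right_diff_distrib)
    qed
    also have "\<dots> = (\<Sum>b\<in>Basis. \<Sum>c\<in>Basis. (h \<bullet> b) * (h \<bullet> c) * H b c x) + 2 * (\<eta> * (norm h)\<^sup>2)"
      by (simp add: sum.distrib \<epsilon>_def power2_eq_square)
    finally show ?thesis unfolding tay phh unfolding ph by simp
  qed
  then show ?thesis using d(1) unfolding H_def by blast
qed

text \<open>In the integrated Taylor bound the linear and mixed quadratic terms vanish by symmetry,
  and each pure square averages to r^2/n, so only the Laplacian survives.\<close>

lemma sphere_integral_polynomial_le:
  fixes q :: "'a::euclidean_space \<Rightarrow> real"
  assumes q: "real_polynomial_function q" and \<eta>: "\<eta> > 0"
  shows "\<exists>d>0. \<forall>r. 0 < r \<and> r < d \<longrightarrow> (LINT y:sphere x r|sphere_measure x r. q y - q x)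
     \<le> sphere_area DIM('a) r * (r\<^sup>2 * (laplacian q x / (2 * real DIM('a)) + \<eta>))"
proof -
  let ?n = "real DIM('a)"
  obtain d where d: "d > 0" "\<And>h. norm h < d \<Longrightarrow>
    q (x + h) \<le> q x + (\<Sum>b\<in>Basis. (h \<bullet> b) * partial_deriv b q x)
      + (\<Sum>b\<in>Basis. \<Sum>c\<in>Basis. (h \<bullet> b) * (h \<bullet> c) * partial_deriv b (partial_deriv c q) x) / 2 + \<eta> * (norm h)\<^sup>2"
    using polynomial_taylor2_le[OF q \<eta>, of x] by blast
  have "(LINT y:sphere x r|sphere_measure x r. q y - q x)
     \<le> sphere_area DIM('a) r * (r\<^sup>2 * (laplacian q x / (2 * ?n) + \<eta>))" if r: "0 < r" "r < d" for r
  proof -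
    let ?I = "\<lambda>f. LINT y:sphere x r|sphere_measure x r. f y :: real"
    let ?S = "sphere_area DIM('a) r"
    define f1 where "f1 y = (\<Sum>b\<in>Basis. partial_deriv b q x * ((y - x) \<bullet> b))" for y
    define f2 where "f2 y = (\<Sum>b\<in>Basis. \<Sum>c\<in>Basis. (partial_deriv b (partial_deriv c q) x / 2) * (((y - x) \<bullet> b) * ((y - x) \<bullet> c)))" for y
    have c1: "continuous_on A f1" and c2: "continuous_on A f2" for A
      unfolding f1_def f2_def by (intro continuous_intros)+
    have "?I (\<lambda>y. q y - q x) \<le> ?I (\<lambda>y. f1 y + f2 y + \<eta> * r\<^sup>2)"
    proof (rule set_integral_mono)
      show "set_integrable (sphere_measure x r) (sphere x r) (\<lambda>y. q y - q x)"
        by (intro set_integrable_sphere_measure continuous_intros continuous_on_real_polynomial_function[OF q])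
      show "set_integrable (sphere_measure x r) (sphere x r) (\<lambda>y. f1 y + f2 y + \<eta> * r\<^sup>2)"
        by (intro set_integrable_sphere_measure continuous_intros c1 c2)
      fix y assume "y \<in> sphere x r"
      then have "norm (y - x) = r" by (simp add: dist_norm norm_minus_commute)
      then show "q y - q x \<le> f1 y + f2 y + \<eta> * r\<^sup>2"
        using d(2)[of "y - x"] r by (simp add: f1_def f2_def mult_ac sum_divide_distrib)
    qed
    also have "\<dots> = ?I f1 + ?I f2 + ?I (\<lambda>y. \<eta> * r\<^sup>2)"
      by (simp add: set_integral_add set_integrable_sphere_measure continuous_intros c1 c2)
    also have "?I f1 = 0"
    proof -
      have "?I f1 = (\<Sum>b\<in>Basis. ?I (\<lambda>y. partial_deriv b q x * ((y - x) \<bullet> b)))"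
        unfolding f1_def by (rule set_integral_sphere_sum) (intro continuous_intros)
      then show ?thesis by (simp add: set_integral_sphere_coord)
    qed
    also have "?I f2 = (\<Sum>b\<in>Basis. (partial_deriv b (partial_deriv b q) x / 2) * (?S * (r\<^sup>2 / ?n)))"
    proof -
      have "?I f2 = (\<Sum>b\<in>Basis. ?I (\<lambda>y. \<Sum>c\<in>Basis. (partial_deriv b (partial_deriv c q) x / 2) * (((y - x) \<bullet> b) * ((y - x) \<bullet> c))))"
        unfolding f2_def by (rule set_integral_sphere_sum) (intro continuous_intros)
      also have "\<dots> = (\<Sum>b\<in>Basis. \<Sum>c\<in>Basis. (partial_deriv b (partial_deriv c q) x / 2) * ?I (\<lambda>y. ((y - x) \<bullet> b) * ((y - x) \<bullet> c)))"
        by (subst set_integral_sphere_sum) (intro continuous_intros, simp)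
      also have "\<dots> = (\<Sum>b\<in>Basis. \<Sum>c\<in>Basis. if c = b then (partial_deriv b (partial_deriv b q) x / 2) * (?S * (r\<^sup>2 / ?n)) else 0)"
        by (intro sum.cong refl) (simp add: set_integral_sphere_coord set_integral_sphere_coord_sq[OF _ r(1)])
      finally show ?thesis by simp
    qed
    also have "\<dots> = ?S * (r\<^sup>2 * (laplacian q x / (2 * ?n)))"
      by (simp add: laplacian_def sum_distrib_right sum_divide_distrib sum_distrib_left field_simps)
    finally show ?thesis unfolding set_integral_sphere_const[OF r(1)] by (simp add: algebra_simps)
  qed
  then show ?thesis using d(1) by blast
qed

subsection \<open>The mean value property and the lift\<close>

text \<open>For r > 0 this is a power series in r^2 with constant term 1, since the real powers
  cancel.\<close>

definition mean_value_factor :: "real \<Rightarrow> real \<Rightarrow> real \<Rightarrow> real" where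
  "mean_value_factor m \<mu> r =
     Gamma (m / 2) * (bessel_I ((m - 2) / 2) (\<mu> * r) / (\<mu> * r / 2) powr ((m - 2) / 2))"

text \<open>As a power series in s = (\<mu> r)^2/4 the factor starts 1 + (2/m) s, so the limit is
  the product of its derivative 2/m at 0 and \<mu>^2/4.\<close>

lemma mean_value_factor_limit:
  assumes m: "m \<ge> 2" and \<mu>: "\<mu> > 0"
  shows "((\<lambda>r. (mean_value_factor m \<mu> r - 1) / r\<^sup>2) \<longlongrightarrow> \<mu>\<^sup>2 / (2 * m)) (at_right 0)"
proof -
  define z where "z = m / 2"
  have z: "z \<ge> 1" using m by (simp add: z_def)
  have znz: "z \<notin> \<int>\<^sub>\<le>\<^sub>0" using z nonpos_Ints_nonpos[of z] by linarith
  have Gz: "Gamma z > 0" using z by (intro Gamma_real_pos) simp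
  define c where "c k = Gamma z / (fact k * Gamma (z + real k))" for k
  \<comment> \<open>The ratio of Gamma values is the reciprocal of a Pochhammer symbol, which is at
    least 1 because z is; the exponential series therefore dominates.\<close>
  have c_bound: "norm (c k * s ^ k) \<le> \<bar>s\<bar> ^ k /\<^sub>R fact k" for k and s :: real
  proof -
    have "pochhammer z k \<ge> 1"
      unfolding pochhammer_prod using z by (intro prod_ge_1) simp
    then have "Gamma (z + real k) \<ge> Gamma z"
      using Gz pochhammer_Gamma[OF znz, of k] by (simp add: field_simps)
    then have "Gamma z / Gamma (z + real k) \<le> 1" and "Gamma (z + real k) > 0" using Gz by auto
    then have "\<bar>c k\<bar> \<le> 1 / fact k"
      using Gz by (simp add: c_def field_simps)
    then have "\<bar>c k\<bar> * \<bar>s\<bar> ^ k \<le> 1 / fact k * \<bar>s\<bar> ^ k"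
      by (rule mult_right_mono) simp
    then show ?thesis by (simp add: abs_mult power_abs divide_inverse mult.commute)
  qed
  have summable: "summable (\<lambda>k. c k * s ^ k)" for s :: real
    by (rule summable_comparison_test'[OF summable_exp_generic[of "\<bar>s\<bar>"], of 0]) (rule c_bound)
  define f where "f s = (\<Sum>k. c k * s ^ k)" for s
  have "(f has_field_derivative (\<Sum>k. diffs c k * 0 ^ k)) (at 0)"
    unfolding f_def by (rule termdiffs_strong_converges_everywhere[OF summable])
  moreover have "(\<Sum>k. diffs c k * 0 ^ k) = 1 / z"
  proof -
    have "Gamma (z + 1) = z * Gamma z" by (rule Gamma_plus1) (fact znz)
    then have "c 1 = 1 / z" using Gz by (simp add: c_def)
    then show ?thesis by (simp add: diffs_def)
  qed
  moreover have f0: "f 0 = 1"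
  proof -
    have "c 0 = 1" using Gz by (simp add: c_def)
    then show ?thesis by (simp add: f_def)
  qed
  ultimately have "((\<lambda>s. (f s - 1) / s) \<longlongrightarrow> 1 / z) (at 0)"
    by (simp add: has_field_derivative_iff)
  moreover have "filterlim (\<lambda>r. (\<mu> * r)\<^sup>2 / 4) (at 0) (at_right 0)"
  proof (rule filterlim_atI)
    have "((\<lambda>r. (\<mu> * r)\<^sup>2 / 4) \<longlongrightarrow> (\<mu> * 0)\<^sup>2 / 4) (at_right 0)" by (intro tendsto_intros) simp
    then show "((\<lambda>r. (\<mu> * r)\<^sup>2 / 4) \<longlongrightarrow> 0) (at_right 0)" by simp
    show "\<forall>\<^sub>F r in at_right 0. (\<mu> * r)\<^sup>2 / 4 \<noteq> 0"
      using \<mu> by (auto simp: eventually_at_right_less eventually_at_filter)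
  qed
  ultimately have "((\<lambda>r. (f ((\<mu> * r)\<^sup>2 / 4) - 1) / ((\<mu> * r)\<^sup>2 / 4)) \<longlongrightarrow> 1 / z) (at_right 0)"
    by (rule filterlim_compose)
  then have "((\<lambda>r. \<mu>\<^sup>2 / 4 * ((f ((\<mu> * r)\<^sup>2 / 4) - 1) / ((\<mu> * r)\<^sup>2 / 4))) \<longlongrightarrow> \<mu>\<^sup>2 / 4 * (1 / z)) (at_right 0)"
    by (rule tendsto_mult_left)
  also have "\<mu>\<^sup>2 / 4 * (1 / z) = \<mu>\<^sup>2 / (2 * m)" by (simp add: z_def)
  finally show ?thesis
  proof (rule Lim_transform_eventually)
    show "\<forall>\<^sub>F r in at_right 0. \<mu>\<^sup>2 / 4 * ((f ((\<mu> * r)\<^sup>2 / 4) - 1) / ((\<mu> * r)\<^sup>2 / 4))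
        = (mean_value_factor m \<mu> r - 1) / r\<^sup>2"
      using eventually_at_right_less[of 0]
    proof eventually_elim
      case (elim r)
      have e: "(m - 2) / 2 + real k + 1 = z + real k" for k by (simp add: z_def field_simps)
      have "mean_value_factor m \<mu> r = Gamma z * (\<Sum>k. ((\<mu> * r)\<^sup>2 / 4) ^ k / (fact k * Gamma (z + real k)))"
        using elim \<mu> unfolding mean_value_factor_def bessel_I_def e by (simp add: z_def)
      also have "\<dots> = f ((\<mu> * r)\<^sup>2 / 4)"
      proof -
        have "summable (\<lambda>k. (Gamma z * (((\<mu> * r)\<^sup>2 / 4) ^ k / (fact k * Gamma (z + real k)))) / Gamma z)"
          using summable[of "(\<mu> * r)\<^sup>2 / 4"] by (intro summable_divide) (simp add: c_def)
        then have "summable (\<lambda>k. ((\<mu> * r)\<^sup>2 / 4) ^ k / (fact k * Gamma (z + real k)))"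
          using Gz by simp
        then show ?thesis by (simp add: f_def c_def suminf_mult[symmetric])
      qed
      finally show ?case using \<mu> elim by (simp add: power_mult_distrib field_simps)
    qed
  qed
qed

text \<open>This is the viscosity subsolution inequality for \<kappa> v: the sphere mean of
  \<kappa>(v - v x) is \<kappa> v x times the factor minus 1, and it is bounded by the mean of q - q
  x. Dividing by r^2 and letting r tend to 0 compares the second-order coefficients. The sign of
  \<kappa> is free, so \<open>v\<close>, \<open>-v\<close> and the cosine weights of the lift are
  all covered.\<close>

lemma mean_value_touching_polynomial:
  fixes v :: "'a::euclidean_space \<Rightarrow> real"
  assumes dim: "DIM('a) \<ge> 2" and \<mu>: "\<mu> > 0" and \<delta>: "\<delta> > 0" and v: "continuous_on (ball x \<delta>) v"
    and mean: "\<And>r. 0 < r \<Longrightarrow> r < \<delta> \<Longrightarrow> mean_value_factor (real DIM('a)) \<mu> r * v x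
      = 1 / sphere_area DIM('a) r * (LINT y:sphere x r|sphere_measure x r. v y)"
    and q: "real_polynomial_function q"
    and touch: "\<And>y. y \<in> ball x \<delta> \<Longrightarrow> \<kappa> * (v y - v x) \<le> q y - q x"
  shows "\<kappa> * \<mu>\<^sup>2 * v x \<le> laplacian q x"
proof -
  let ?n = "real DIM('a)" and ?a = "mean_value_factor (real DIM('a)) \<mu>"
  have "\<kappa> * v x * (\<mu>\<^sup>2 / (2 * ?n)) \<le> laplacian q x / (2 * ?n) + \<eta>" if \<eta>: "\<eta> > 0" for \<eta>
  proof (rule tendsto_upperbound)
    show "((\<lambda>r. \<kappa> * v x * ((?a r - 1) / r\<^sup>2)) \<longlongrightarrow> \<kappa> * v x * (\<mu>\<^sup>2 / (2 * ?n))) (at_right 0)"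
      by (intro tendsto_mult_left mean_value_factor_limit \<mu>) (use dim in simp)
    obtain d where d: "d > 0" "\<And>r. 0 < r \<Longrightarrow> r < d \<Longrightarrow> (LINT y:sphere x r|sphere_measure x r. q y - q x)
        \<le> sphere_area DIM('a) r * (r\<^sup>2 * (laplacian q x / (2 * ?n) + \<eta>))"
      using sphere_integral_polynomial_le[OF q \<eta>, of x] by blast
    have "\<kappa> * v x * ((?a r - 1) / r\<^sup>2) \<le> laplacian q x / (2 * ?n) + \<eta>"
      if r: "0 < r" "r < min d \<delta>" for r
    proof -
      let ?I = "\<lambda>f. LINT y:sphere x r|sphere_measure x r. f y :: real"
      let ?S = "sphere_area DIM('a) r"
      have S: "?S > 0" using r by (intro sphere_area_pos) auto
      have cv: "continuous_on (sphere x r) v" by (rule continuous_on_subset[OF v]) (use r in auto)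
      have "?I v = ?S * (?a r * v x)" using mean[of r] r S by (simp add: field_simps)
      then have "?S * (\<kappa> * v x * (?a r - 1)) = \<kappa> * (?I v - ?I (\<lambda>y. v x))"
        unfolding set_integral_sphere_const[OF r(1)] by (simp add: algebra_simps)
      also have "\<dots> = ?I (\<lambda>y. \<kappa> * (v y - v x))"
        by (simp add: set_integral_diff set_integrable_sphere_measure cv)
      also have "\<dots> \<le> ?I (\<lambda>y. q y - q x)"
      proof (rule set_integral_mono)
        show "set_integrable (sphere_measure x r) (sphere x r) (\<lambda>y. \<kappa> * (v y - v x))"
          by (intro set_integrable_sphere_measure continuous_intros cv)
        show "set_integrable (sphere_measure x r) (sphere x r) (\<lambda>y. q y - q x)"
          by (intro set_integrable_sphere_measure continuous_intros continuous_on_real_polynomial_function[OF q])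
      qed (use touch r in auto)
      also have "\<dots> \<le> ?S * (r\<^sup>2 * (laplacian q x / (2 * ?n) + \<eta>))" using d(2) r by simp
      finally have "\<kappa> * v x * (?a r - 1) \<le> r\<^sup>2 * (laplacian q x / (2 * ?n) + \<eta>)"
        using S by simp
      then show ?thesis using r(1) by (simp add: pos_divide_le_eq mult.commute)
    qed
    then show "\<forall>\<^sub>F r in at_right 0. \<kappa> * v x * ((?a r - 1) / r\<^sup>2) \<le> laplacian q x / (2 * ?n) + \<eta>"
      unfolding eventually_at_right_field using d(1) \<delta> by (intro exI[of _ "min d \<delta>"]) auto
  qed simp
  then have "\<kappa> * v x * (\<mu>\<^sup>2 / (2 * ?n)) \<le> laplacian q x / (2 * ?n)" by (rule field_le_epsilon)
  then show ?thesis by (simp add: field_simps)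
qed

section \<open>Slices at a fixed value of the extra variable, and localisation\<close>

lemma real_polynomial_function_slice:
  fixes h :: "'a::euclidean_space \<times> real \<Rightarrow> real"
  assumes "real_polynomial_function h"
  shows "real_polynomial_function (\<lambda>x. h (x, t))"
  using assms
proof (induction rule: real_polynomial_function.induct)
  case (linear f)
  have "bounded_linear (\<lambda>x. f (x, 0))"
    by (rule bounded_linear_compose[OF linear.hyps]) (intro bounded_linear_Pair bounded_linear_ident bounded_linear_zero)
  then have "real_polynomial_function (\<lambda>x. f (x, 0) + f (0, t))"
    by (intro real_polynomial_function.intros)
  moreover have "(\<lambda>x. f (x, t)) = (\<lambda>x. f (x, 0) + f (0, t))"
  proof
    fix x
    have "f ((x, 0) + (0, t)) = f (x, 0) + f (0, t)"
      by (rule linear_add[OF bounded_linear.linear[OF linear.hyps]])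
    then show "f (x, t) = f (x, 0) + f (0, t)" by (simp only: add_Pair add_0_right add_0_left)
  qed
  ultimately show ?case by (simp only:)
qed auto

lemma partial_deriv_slice:
  "partial_deriv b (\<lambda>x. F (x, t)) = (\<lambda>x. partial_deriv (b, 0) F (x, t :: real))"
  by (simp add: partial_deriv_def[abs_def])

text \<open>The basis of the product consists of the vectors (b, 0) and (0, 1), and derivatives
  along (b, 0) are literally those of the slice. The identity thus applies to polynomials and to the
  lift alike.\<close>

lemma laplacian_slice:
  fixes F :: "'a::euclidean_space \<times> real \<Rightarrow> real"
  shows "laplacian F (x, t) = laplacian (\<lambda>x. F (x, t)) x + partial_deriv (0, 1) (partial_deriv (0, 1) F) (x, t)"
proof -
  have "inj_on (\<lambda>u::'a. (u, 0::real)) Basis" by (auto simp: inj_on_def)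
  moreover have "(\<lambda>u::'a. (u, 0::real)) ` Basis \<inter> {(0, 1)} = {}" by auto
  ultimately show ?thesis
    unfolding laplacian_def Basis_prod_def
    by (simp add: sum.union_disjoint sum.reindex partial_deriv_slice)
qed

lemma C_diff_on_slice:
  fixes F :: "'a::euclidean_space \<times> real \<Rightarrow> real"
  assumes "C_diff_on k F S" and "\<And>x. x \<in> T \<Longrightarrow> (x, t) \<in> S"
  shows "C_diff_on k (\<lambda>x. F (x, t)) T"
  using assms(1)
proof (induction k arbitrary: F)
  have cont: "continuous_on T (\<lambda>x. G (x, t))" if "continuous_on S G" for G :: "'a \<times> real \<Rightarrow> real"
    by (rule continuous_on_compose2[OF that]) (use assms(2) in \<open>auto intro!: continuous_intros\<close>)
  {
    case 0
    then show ?case using cont by simp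
  next
    case (Suc k)
    have b: "(b, 0) \<in> Basis" if "b \<in> Basis" for b :: 'a
      using that by (simp add: Basis_prod_def)
    have "(\<lambda>s. F (x + s *\<^sub>R b, t)) field_differentiable at 0" if "x \<in> T" "b \<in> Basis" for x b
      using Suc.prems assms(2)[OF that(1)] b[OF that(2)] by fastforce
    moreover have "C_diff_on k (\<lambda>x. partial_deriv (b, 0) F (x, t)) T" if "b \<in> Basis" for b
      by (rule Suc.IH) (use Suc.prems b[OF that] in auto)
    ultimately show ?case using Suc.prems cont by (simp add: partial_deriv_slice)
  }
qed

lemma C_diff_on_local:
  fixes f :: "'a::euclidean_space \<Rightarrow> real"
  assumes "\<And>x. x \<in> S \<Longrightarrow> \<exists>r>0. C_diff_on k f (ball x r)"
  shows "C_diff_on k f S"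
  using assms
proof (induction k arbitrary: f)
  have cont: "continuous_on S f" if "\<And>x. x \<in> S \<Longrightarrow> \<exists>r>0. continuous_on (ball x r) f" for f :: "'a \<Rightarrow> real"
    using that by (meson centre_in_ball continuous_at_imp_continuous_on continuous_on_eq_continuous_at open_ball)
  {
    case 0
    then show ?case using cont by simp
  next
    case (Suc k)
    have "continuous_on S f" using Suc.prems by (intro cont) force
    moreover have "C_diff_on k (partial_deriv b f) S" if b: "b \<in> Basis" for b
      using Suc.prems b by (intro Suc.IH) force
    moreover have "(\<lambda>t. f (x + t *\<^sub>R b)) field_differentiable at 0" if "b \<in> Basis" "x \<in> S" for b x
      using Suc.prems[OF that(2)] that(1) by force
    ultimately show ?case by simp
  }
qed

text \<open>At an interior maximum, the mean value property plays the role of the second derivative test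
  in the directions of \<open>x\<close>, in which \<open>v\<close> is not known to be differentiable.\<close>

lemma mean_value_lift_le_harmonic:
  fixes D :: "'a::euclidean_space set" and v :: "'a \<Rightarrow> real"
  assumes dim: "DIM('a) \<ge> 2" and \<mu>: "\<mu> > 0" and v: "continuous_on D v" and \<rho>: "\<And>x. x \<in> D \<Longrightarrow> \<rho> x > 0"
    and mean: "\<And>x r. x \<in> D \<Longrightarrow> 0 < r \<Longrightarrow> r < \<rho> x \<Longrightarrow> mean_value_factor (real DIM('a)) \<mu> r * v x
      = 1 / sphere_area DIM('a) r * (LINT y:sphere x r|sphere_measure x r. v y)"
    and D: "cball x0 R \<subseteq> D" and h: "harmonic_polynomial h"
    and bd: "\<And>z. z \<in> sphere (x0, 0) R \<Longrightarrow> \<kappa> * (v (fst z) * cos (\<mu> * snd z)) - h z \<le> \<epsilon>"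
    and z: "z \<in> cball (x0, 0) R"
  shows "\<kappa> * (v (fst z) * cos (\<mu> * snd z)) - h z \<le> \<epsilon>"
proof (rule field_le_epsilon)
  fix e :: real assume e: "e > 0"
  let ?z0 = "(x0, 0 :: real)"
  define V where "V z = \<kappa> * (v (fst z) * cos (\<mu> * snd z))" for z
  define \<delta> where "\<delta> = e / (R\<^sup>2 + 1)"
  have \<delta>: "\<delta> > 0" using e by (simp add: \<delta>_def add_nonneg_pos)
  have \<delta>R: "\<delta> * R\<^sup>2 < e"
  proof -
    have "\<delta> * (R\<^sup>2 + 1) = e" by (simp add: \<delta>_def add_nonneg_eq_0_iff)
    then show ?thesis using \<delta> by (simp add: ring_distribs)
  qed
  have ph: "real_polynomial_function h" and lh: "\<And>z. laplacian h z = 0"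
    using h by (auto simp: harmonic_polynomial_def)
  \<comment> \<open>Subtracting the quadratic term makes \<open>g\<close> strictly superharmonic,
    while W = V - g exceeds V - h by at most \<delta> R^2 < e on the sphere.\<close>
  define g where "g = (\<lambda>z. h z - \<delta> * (norm (z - ?z0))\<^sup>2)"
  have pg: "real_polynomial_function g" unfolding g_def by (intro polynomial_intros ph)
  have lg: "laplacian g z < 0" for z
    using \<delta> by (simp add: g_def laplacian_diff laplacian_cmult laplacian_sq_dist polynomial_intros ph lh
        add_pos_pos)
  define W where "W z = V z - g z" for z
  have W_ge: "V y - h y \<le> W y" for y using \<delta> by (simp add: W_def g_def)
  have fst_D: "fst y \<in> D" if "y \<in> cball ?z0 R" for y
    using that D dist_fst_le[of ?z0 y] by auto
  have "V z - h z \<le> \<epsilon> + e"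
  proof (rule ccontr)
    assume "\<not> V z - h z \<le> \<epsilon> + e"
    then have lt: "W y < W z" if "y \<in> sphere ?z0 R" for y
      using bd[OF that] that W_ge[of z] \<delta>R by (auto simp: W_def V_def g_def dist_norm norm_minus_commute)
    have "continuous_on (cball ?z0 R) W"
      unfolding W_def V_def
      by (intro continuous_intros continuous_on_compose2[OF v] continuous_on_real_polynomial_function pg)
        (use fst_D in auto)
    then obtain z1 d where z1: "z1 \<in> ball ?z0 R" "d > 0" "ball z1 d \<subseteq> ball ?z0 R"
        "\<And>y. y \<in> ball ?z0 R \<Longrightarrow> W y \<le> W z1"
      using continuous_attains_sup_ball_interior[of ?z0 R W z] z lt by metis
    obtain x t where xt: "z1 = (x, t)" by (cases z1)
    have x: "x \<in> D" using fst_D[of z1] z1(1) xt by auto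
    have max: "W y \<le> W (x, t)" if "dist y (x, t) < d" for y
      using z1 that xt by (auto simp: subset_eq dist_commute)
    define q where "q y = g (y, t)" for y
    have "\<kappa> * cos (\<mu> * t) * \<mu>\<^sup>2 * v x \<le> laplacian q x"
    \<comment> \<open>Below \<open>d\<close> the maximum of \<open>W\<close> makes the slice of
      \<open>g\<close> touch a multiple of \<open>v\<close> from above; below
      \<open>\<rho> x\<close> the mean value property is available.\<close>
    proof (rule mean_value_touching_polynomial[where \<delta> = "min d (\<rho> x)"])
      show "continuous_on (ball x (min d (\<rho> x))) v"
      proof (rule continuous_on_subset[OF v], rule subsetI)
        fix y assume "y \<in> ball x (min d (\<rho> x))"
        then have "(y, t) \<in> ball z1 d" by (simp add: xt dist_Pair_Pair)
        then show "y \<in> D" using z1(3) fst_D[of "(y, t)"] by auto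
      qed
      show "real_polynomial_function q"
        using real_polynomial_function_slice[OF pg] by (simp add: q_def[abs_def])
      fix y assume "y \<in> ball x (min d (\<rho> x))"
      then have "W (y, t) \<le> W (x, t)" by (intro max) (simp add: dist_Pair_Pair dist_commute)
      then show "\<kappa> * cos (\<mu> * t) * (v y - v x) \<le> q y - q x"
        by (simp add: W_def V_def q_def algebra_simps)
    qed (use dim \<mu> z1(2) \<rho>[OF x] mean[OF x] in auto)
    moreover have "- (\<kappa> * v x * \<mu>\<^sup>2 * cos (\<mu> * t)) - partial_deriv (0, 1) (partial_deriv (0, 1) g) (x, t) \<le> 0"
    proof (rule second_derivative_local_max[where a = t and d = d])
      have der: "((\<lambda>s. p (x, s)) has_real_derivative partial_deriv (0, 1) p (x, s)) (at s)"
        if "real_polynomial_function p" for p :: "'a \<times> real \<Rightarrow> real" and s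
        using has_partial_deriv_poly_at[OF that, of "(x, 0)" "(0, 1)" s] by simp
      show "((\<lambda>s. W (x, s)) has_real_derivative - (\<kappa> * v x * \<mu> * sin (\<mu> * s)) - partial_deriv (0, 1) g (x, s)) (at s)" for s
        unfolding W_def V_def by (auto intro!: derivative_eq_intros der pg)
      show "((\<lambda>s. - (\<kappa> * v x * \<mu> * sin (\<mu> * s)) - partial_deriv (0, 1) g (x, s)) has_real_derivative
          - (\<kappa> * v x * \<mu>\<^sup>2 * cos (\<mu> * t)) - partial_deriv (0, 1) (partial_deriv (0, 1) g) (x, t)) (at t)"
        by (auto intro!: derivative_eq_intros der real_polynomial_function_partial_deriv pg simp: power2_eq_square)
      show "W (x, s) \<le> W (x, t)" if "\<bar>s - t\<bar> < d" for s
        using that by (intro max) (simp add: dist_Pair_Pair dist_real_def)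
    qed (fact z1(2))
    moreover have "laplacian g (x, t) = laplacian q x + partial_deriv (0, 1) (partial_deriv (0, 1) g) (x, t)"
      unfolding q_def by (rule laplacian_slice)
    \<comment> \<open>The contributions \<kappa> \<mu>^2 v(x) cos(\<mu> t) from the space directions
      and from the extra variable have opposite signs and cancel.\<close>
    ultimately have "laplacian g (x, t) \<ge> 0" by (simp add: mult_ac)
    then show False using lg[of "(x, t)"] by simp
  qed
  then show "\<kappa> * (v (fst z) * cos (\<mu> * snd z)) - h z \<le> \<epsilon> + e" by (simp add: V_def)
qed

theorem theorem7:
  fixes D :: "'a::euclidean_space set" and v :: "'a \<Rightarrow> real"
    and \<mu> :: real and \<rho> :: "'a \<Rightarrow> real"
  assumes dim: "DIM('a) \<ge> 2"
    and domain: "open D" "connected D" "bounded D"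
    and cont: "continuous_on D v"
    and mu: "\<mu> > 0"
    and admissible: "\<And>x. x \<in> D \<Longrightarrow> \<rho> x > 0 \<and> closure (ball x (\<rho> x)) \<subseteq> D"
    and mean_value: "\<And>x r. x \<in> D \<Longrightarrow> 0 < r \<Longrightarrow> r < \<rho> x \<Longrightarrow>
      Gamma (real DIM('a) / 2) *
        (bessel_I ((real DIM('a) - 2) / 2) (\<mu> * r) / (\<mu> * r / 2) powr ((real DIM('a) - 2) / 2)) * v x
      = 1 / sphere_area DIM('a) r * (LINT y:sphere x r|sphere_measure x r. v y)"
  shows "satisfies_modified_Helmholtz \<mu> v D"
proof -
  define F where "F z = v (fst z) * cos (\<mu> * snd z)" for z
  have slice: "(\<lambda>x. F (x, 0)) = v" by (simp add: F_def)
  have "\<exists>r>0. C_diff_on 2 v (ball x0 r) \<and> laplacian v x0 - \<mu>\<^sup>2 * v x0 = 0" if x0: "x0 \<in> D" for x0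
  proof -
    \<comment> \<open>This radius is chosen independently of \<open>\<rho> x0\<close>; the
      comparison uses \<open>\<rho>\<close> only at a point where a maximum is attained.\<close>
    obtain R where R: "R > 0" "cball x0 R \<subseteq> D" using domain(1) x0 open_contains_cball by blast
    have fst_D: "fst z \<in> D" if "z \<in> cball (x0, 0 :: real) R" for z
      using that R(2) dist_fst_le[of "(x0, 0)" z] by auto
    have contF: "continuous_on (cball (x0, 0) R) F"
      unfolding F_def
      by (intro continuous_intros continuous_on_compose2[OF cont]) (use fst_D in auto)
    have "\<exists>h. harmonic_polynomial h \<and> (\<forall>z\<in>sphere (x0, 0) R. \<bar>F z - h z\<bar> < 1 / real (Suc n))" for n
    proof (rule harmonic_polynomial_approx_sphere)
      show "continuous_on (sphere (x0, 0) R) F" by (rule continuous_on_subset[OF contF]) auto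
    qed (use dim in auto)
    then obtain h where h: "\<And>n. harmonic_polynomial (h n)"
      "\<And>n z. z \<in> sphere (x0, 0) R \<Longrightarrow> \<bar>F z - h n z\<bar> < 1 / real (Suc n)" by metis
    note lift_le = mean_value_lift_le_harmonic[OF dim mu cont _ mean_value[folded mean_value_factor_def] R(2)]
    have approx: "\<bar>F z - h n z\<bar> \<le> 1 / real (Suc n)" if z: "z \<in> cball (x0, 0) R" for n z
    proof -
      have "1 * (v (fst z) * cos (\<mu> * snd z)) - h n z \<le> 1 / real (Suc n)"
      proof (rule lift_le)
        fix y :: "'a \<times> real" assume "y \<in> sphere (x0, 0) R"
        then show "1 * (v (fst y) * cos (\<mu> * snd y)) - h n y \<le> 1 / real (Suc n)"
          using h(2)[of y n] by (simp add: F_def)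
      qed (use admissible h z in auto)
      \<comment> \<open>The opposite bound is the same comparison with \<kappa> = -1 and the
        harmonic polynomial \<open>- h n\<close>.\<close>
      moreover have "- 1 * (v (fst z) * cos (\<mu> * snd z)) - - h n z \<le> 1 / real (Suc n)"
      proof (rule lift_le)
        fix y :: "'a \<times> real" assume "y \<in> sphere (x0, 0) R"
        then show "- 1 * (v (fst y) * cos (\<mu> * snd y)) - - h n y \<le> 1 / real (Suc n)"
          using h(2)[of y n] by (simp add: F_def)
      qed (use admissible harmonic_polynomial_uminus[OF h(1)] z in auto)
      ultimately show ?thesis by (simp add: F_def)
    qed
    have lim: "uniform_limit (cball (x0, 0) R) h F sequentially"
    proof (rule uniform_limitI)
      fix e :: real assume "e > 0"
      then have "\<forall>\<^sub>F n in sequentially. 1 / real (Suc n) < e"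
        using order_tendstoD(2)[OF LIMSEQ_inverse_real_of_nat] by (simp add: inverse_eq_divide)
      then show "\<forall>\<^sub>F n in sequentially. \<forall>z\<in>cball (x0, 0) R. dist (h n z) (F z) < e"
      proof eventually_elim
        case (elim n)
        show ?case
        proof
          fix z assume "z \<in> cball (x0, 0 :: real) R"
          from approx[OF this, of n] elim show "dist (h n z) (F z) < e"
            by (simp add: dist_real_def abs_minus_commute)
        qed
      qed
    qed
    have R2: "R / 2 < R" using R by simp
    note limit = harmonic_polynomials_limit_harmonic[OF h(1) lim R2]
    have "C_diff_on 2 v (ball x0 (R / 2))"
      using C_diff_on_slice[OF limit(1), of "ball x0 (R / 2)" 0] by (simp add: slice dist_Pair_Pair)
    moreover have "laplacian v x0 - \<mu>\<^sup>2 * v x0 = 0"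
    proof -
      \<comment> \<open>In the extra variable \<open>F\<close> is an explicit cosine with second
        derivative \<open>-\<mu>\<^sup>2 * F\<close>, so harmonicity at \<open>(x0, 0)\<close>,
        where the cosine is 1, is the equation for \<open>v\<close> at \<open>x0\<close>.\<close>
      have "partial_deriv (0, 1) F = (\<lambda>z. - (\<mu> * v (fst z) * sin (\<mu> * snd z)))"
        by (rule partial_deriv_eq_fun) (auto simp: F_def intro!: derivative_eq_intros)
      moreover have "partial_deriv (0, 1) (\<lambda>z. - (\<mu> * v (fst z) * sin (\<mu> * snd z))) = (\<lambda>z. - (\<mu>\<^sup>2 * F z))"
        by (rule partial_deriv_eq_fun) (auto simp: F_def power2_eq_square intro!: derivative_eq_intros)
      ultimately have "laplacian F (x0, 0) = laplacian v x0 - \<mu>\<^sup>2 * v x0"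
        unfolding laplacian_slice by (simp add: slice) (simp add: F_def)
      then show ?thesis using limit(2)[of "(x0, 0)"] R by simp
    qed
    ultimately show ?thesis using R by (intro exI[of _ "R / 2"]) auto
  qed
  then show ?thesis
    unfolding satisfies_modified_Helmholtz_def using C_diff_on_local[of D 2 v] by blast
qed

end
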